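(* Let $p>2$ and let $\mathcal{D}\subset\mathbb{H}$ be open, bounded and connected. Assume that for every bounded $F\in\mathcal{C}(\mathbb{H})$, the family $\{u_\epsilon\}_{\epsilon\to0}$ of the unique bounded continuous solutions of $$u(q)=d_\epsilon(q)\Big(\frac13\mathcal{A}_3(u,\epsilon)(q)+\frac13\inf_{q'\in B_{\gamma_p\epsilon}(q)}\mathcal{A}_3(u,\epsilon)(q')+\frac13\sup_{q'\in B_{\gamma_p\epsilon}(q)}\mathcal{A}_3(u,\epsilon)(q')\Big)+(1-d_\epsilon(q))F(q),\quad q\in\mathbb{H},$$ is equicontinuous in $\bar{\mathcal{D}}$. Then $\mathcal{D}$ is game-regular.
   Context: $\mathbb{H}=(\mathbb{R}^3,* )$ is the first Heisenberg group with $(x,y,z)*(x',y',z')=(x+x',y+y',z+z'+\frac12(xy'-yx'))$. The Korányi gauge is $|(x,y,z)|_K=((x^2+y^2)^2+16z^2)^{1/4}$, the metric is $d(q,q')=|q^{-1}*q'|_K$, $B_r(q)=\{q'\in\mathbb{H}: d(q,q')<r\}$, the dilations are $\rho_\lambda(x,y,z)=(\lambda x,\lambda y,\lambda^2z)$, and $|\cdot|$ is the Euclidean norm. Define $\mathcal{A}_3(v,r)(q)=\frac{1}{|B_r(q)|}\int_{B_r(q)}v(p)\,dp$ (Lebesgue measure on $\mathbb{R}^3$), $d_\epsilon(q)=\frac1\epsilon\min\{\epsilon,\mathrm{dist}(q,\mathbb{H}\setminus\mathcal{D})\}$ with $\mathrm{dist}$ taken with respect to $d$, and $\gamma_p=\big(\frac{p-2}{\pi}\big)^{1/2}$.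 The family $\{u_\epsilon\}_{\epsilon\to0}$ is equicontinuous in $\bar{\mathcal{D}}$ means: for every $\eta>0$ there exist $\delta>0$ and $\hat\epsilon\in(0,1)$ such that $|u_\epsilon(q)-u_\epsilon(q')|\le\eta$ for all $\epsilon\in(0,\hat\epsilon)$ and all $q,q'\in\bar{\mathcal{D}}$ with $|q-q'|\le\delta$. Tug of War game with noise on $\mathcal{D}$: let $\Omega_1=B_1(0)\times\{1,2,3\}\times(0,1)$ with the product $\mathbb{P}_1$ of normalized Lebesgue measure on $B_1(0)$, uniform measure on $\{1,2,3\}$ and Lebesgue measure on $(0,1)$ (Borel/discrete $\sigma$-algebras), and let $(\Omega,\mathcal{F},\mathbb{P})$ be the countable product of copies of $\Omega_1$, with elements $\omega=\{(w_i,s_i,t_i)\}_{i\ge1}$. A strategy of a player is a sequence $\sigma=\{\sigma^n\}_{n\ge0}$ of measurable functions $\sigma^n:H_n\to B_1(0)$ on the spaces of finite histories $H_n=\mathbb{H}\times(\mathbb{H}\times\Omega_1)^n$. Given $\epsilon\in(0,1)$, an initial position $q_0\in\mathbb{H}$ and strategies $\sigma_I,\sigma_{II}$ of the two players, the positions $Q_n=Q_n^{\epsilon,q_0,\sigma_I,\sigma_{II}}:\Omega\to\mathbb{H}$ are: $Q_0=q_0$ and, with $q_k=Q_k$ and $h_{n-1}=(q_0,(q_1,w_1,s_1,t_1),\ldots,(q_{n-1},w_{n-1},s_{n-1},t_{n-1}))\in H_{n-1}$, $$Q_n=\begin{cases}q_{n-1}*\rho_{\gamma_p\epsilon}(\sigma_I^{n-1}(h_{n-1}))*\rho_\epsilon(w_n)&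 s_n=1\\ q_{n-1}*\rho_{\gamma_p\epsilon}(\sigma_{II}^{n-1}(h_{n-1}))*\rho_\epsilon(w_n)& s_n=2\\ q_{n-1}*\rho_\epsilon(w_n)& s_n=3.\end{cases}$$ The stopping time is $\tau=\tau^{\epsilon,q_0,\sigma_I,\sigma_{II}}=\min\{n\ge1:\ t_n>d_\epsilon(q_{n-1})\}$, which is almost surely finite. A point $q_0\in\partial\mathcal{D}$ is game-regular if for every $\eta,\delta>0$ there exist $\hat\delta\in(0,\delta)$ and $\hat\epsilon\in(0,1)$ such that for every $\epsilon\in(0,\hat\epsilon)$ and every initial position $p_0\in B_{\hat\delta}(q_0)$ there exists a strategy $\sigma_{0,I}$ with the property that for every strategy $\sigma_{II}$: $\mathbb{P}\big((Q^{\epsilon,p_0,\sigma_{0,I},\sigma_{II}})_{\tau-1}\in B_\delta(q_0)\big)\ge1-\eta$. The domain $\mathcal{D}$ is game-regular if every $q_0\in\partial\mathcal{D}$ is game-regular. *)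

theory Defs
  imports "HOL-Probability.Probability"
begin

section \<open>The first Heisenberg group\<close>

text \<open>
  The carrier is the product type, whose \<^const>\<open>norm\<close> is the Euclidean norm, whose topology is the
  Euclidean one (it agrees with that of the Koranyi metric) and whose \<^const>\<open>lborel\<close> is the
  three-dimensional Lebesgue measure. The neutral element is \<open>0\<close>. The library's \<^const>\<open>dist\<close>,
  \<^const>\<open>ball\<close> and \<^const>\<open>infdist\<close> are Euclidean; the Koranyi versions are defined here.
\<close>

type_synonym heis = "real \<times> real \<times> real"

fun hmult :: "heis \<Rightarrow> heis \<Rightarrow> heis" (infixl "\<odot>" 70) where
  "(x, y, z) \<odot> (x', y', z') = (x + x', y + y', z + z' + (x * y' - y * x') / 2)"

definition hinv :: "heis \<Rightarrow> heis" where
  "hinv q = - q"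

lemma hmult_assoc: "(a \<odot> b) \<odot> c = a \<odot> (b \<odot> c)"
  by (cases a; cases b; cases c) (simp add: field_simps)

lemma hmult_0 [simp]: "0 \<odot> q = q" "q \<odot> 0 = q"
  by (cases q; simp add: zero_prod_def)+

lemma hmult_hinv [simp]: "hinv q \<odot> q = 0" "q \<odot> hinv q = 0"
  by (cases q; simp add: hinv_def zero_prod_def)+

fun koranyi_gauge :: "heis \<Rightarrow> real" where
  "koranyi_gauge (x, y, z) = root 4 ((x\<^sup>2 + y\<^sup>2)\<^sup>2 + 16 * z\<^sup>2)"

definition hdist :: "heis \<Rightarrow> heis \<Rightarrow> real" where
  "hdist q q' = koranyi_gauge (hinv q \<odot> q')"

definition hball :: "heis \<Rightarrow> real \<Rightarrow> heis set" where
  "hball q r = {q'. hdist q q' < r}"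

fun hdilate :: "real \<Rightarrow> heis \<Rightarrow> heis" where
  "hdilate l (x, y, z) = (l * x, l * y, l\<^sup>2 * z)"

section \<open>The dynamic programming principle\<close>

definition havg :: "(heis \<Rightarrow> real) \<Rightarrow> real \<Rightarrow> heis \<Rightarrow> real" where
  "havg v r q = (LINT p:hball q r|lborel. v p) / measure lborel (hball q r)"

definition cutoff :: "heis set \<Rightarrow> real \<Rightarrow> heis \<Rightarrow> real" where
  "cutoff D \<epsilon> q = min \<epsilon> (INF q'\<in>- D. hdist q q') / \<epsilon>"

definition gamma_p :: "real \<Rightarrow> real" where
  "gamma_p p = sqrt ((p - 2) / pi)"

definition dpp_solution ::
    "heis set \<Rightarrow> real \<Rightarrow> (heis \<Rightarrow> real) \<Rightarrow> real \<Rightarrow> (heis \<Rightarrow> real) \<Rightarrow> bool" where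
  "dpp_solution D p F \<epsilon> u \<longleftrightarrow>
     continuous_on UNIV u \<and> bounded (range u) \<and>
     (\<forall>q. u q = cutoff D \<epsilon> q *
                  (1/3 * havg u \<epsilon> q
                   + 1/3 * (INF q'\<in>hball q (gamma_p p * \<epsilon>). havg u \<epsilon> q')
                   + 1/3 * (SUP q'\<in>hball q (gamma_p p * \<epsilon>). havg u \<epsilon> q'))
                + (1 - cutoff D \<epsilon> q) * F q)"

definition equicontinuous_family_on :: "heis set \<Rightarrow> (real \<Rightarrow> heis \<Rightarrow> real) \<Rightarrow> bool" where
  "equicontinuous_family_on S u \<longleftrightarrow>
     (\<forall>\<eta>>0. \<exists>\<delta>>0. \<exists>\<epsilon>'\<in>{0<..<1}. \<forall>\<epsilon>\<in>{0<..<\<epsilon>'}. \<forall>q\<in>S. \<forall>q'\<in>S.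
        norm (q - q') \<le> \<delta> \<longrightarrow> \<bar>u \<epsilon> q - u \<epsilon> q'\<bar> \<le> \<eta>)"

section \<open>Tug of War with noise\<close>

type_synonym outcome = "heis \<times> nat \<times> real"

text \<open>
  \<^const>\<open>uniform_measure\<close> keeps all of the ambient type as its space; \<^const>\<open>restrict_space\<close> cuts it
  down, so that \<open>space step_space = hball 0 1 \<times> {1, 2, 3} \<times> {0<..<1}\<close>.
\<close>

definition step_space :: "outcome measure" where
  "step_space =
     restrict_space (uniform_measure lborel (hball 0 1)) (hball 0 1) \<Otimes>\<^sub>M
     (uniform_count_measure {1, 2, 3} \<Otimes>\<^sub>M restrict_space lborel {0<..<1})"

definition game_space :: "(nat \<Rightarrow> outcome) measure" where
  "game_space = (\<Pi>\<^sub>M i\<in>{1..}. step_space)"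

text \<open>
  An element \<open>(q\<^sub>0, h)\<close> of the \<open>n\<close>-th history space consists of the initial position and of the
  entries \<open>h k = (q\<^sub>k, w\<^sub>k, s\<^sub>k, t\<^sub>k)\<close> for \<open>1 \<le> k \<le> n\<close>; being an element of a \<^const>\<open>PiM\<close> space,
  \<open>h\<close> is \<^const>\<open>undefined\<close> elsewhere.
\<close>

type_synonym history = "heis \<times> (nat \<Rightarrow> heis \<times> outcome)"

definition history_space :: "nat \<Rightarrow> history measure" where
  "history_space n = borel \<Otimes>\<^sub>M (\<Pi>\<^sub>M k\<in>{1..n}. borel \<Otimes>\<^sub>M step_space)"

definition strategy :: "(nat \<Rightarrow> history \<Rightarrow> heis) \<Rightarrow> bool" where
  "strategy \<sigma> \<longleftrightarrow> (\<forall>n. \<sigma> n \<in> history_space n \<rightarrow>\<^sub>M restrict_space borel (hball 0 1))"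

context
begin

private lemma restrict_fundef_cong [fundef_cong]:
  assumes "A = B" and "\<And>k. k \<in> B \<Longrightarrow> f k = g k"
  shows "restrict f A = restrict g B"
  using assms by (auto simp: restrict_def)

fun position ::
    "real \<Rightarrow> real \<Rightarrow> heis \<Rightarrow> (nat \<Rightarrow> history \<Rightarrow> heis) \<Rightarrow> (nat \<Rightarrow> history \<Rightarrow> heis) \<Rightarrow>
     nat \<Rightarrow> (nat \<Rightarrow> outcome) \<Rightarrow> heis" where
  "position p \<epsilon> q\<^sub>0 \<sigma>\<^sub>I \<sigma>\<^sub>I\<^sub>I 0 \<omega> = q\<^sub>0"
| "position p \<epsilon> q\<^sub>0 \<sigma>\<^sub>I \<sigma>\<^sub>I\<^sub>I (Suc m) \<omega> =
     (let q = position p \<epsilon> q\<^sub>0 \<sigma>\<^sub>I \<sigma>\<^sub>I\<^sub>I m \<omega>;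
          h = (q\<^sub>0, \<lambda>k\<in>{1..m}. (position p \<epsilon> q\<^sub>0 \<sigma>\<^sub>I \<sigma>\<^sub>I\<^sub>I k \<omega>, \<omega> k));
          (w, s, t) = \<omega> (Suc m)
      in if s = 1 then q \<odot> hdilate (gamma_p p * \<epsilon>) (\<sigma>\<^sub>I m h) \<odot> hdilate \<epsilon> w
         else if s = 2 then q \<odot> hdilate (gamma_p p * \<epsilon>) (\<sigma>\<^sub>I\<^sub>I m h) \<odot> hdilate \<epsilon> w
         else q \<odot> hdilate \<epsilon> w)"

end

text \<open>
  On the null event that no such \<open>n\<close> exists, the value is the fixed number \<open>LEAST n. False\<close>, so
  events expressed through the stopping time are measurable, and this choice does not affect their
  probability.
\<close>

definition stop_time ::
    "heis set \<Rightarrow> real \<Rightarrow> real \<Rightarrow> heis \<Rightarrow> (nat \<Rightarrow> history \<Rightarrow> heis) \<Rightarrow> (nat \<Rightarrow> history \<Rightarrow> heis) \<Rightarrow>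
     (nat \<Rightarrow> outcome) \<Rightarrow> nat" where
  "stop_time D p \<epsilon> q\<^sub>0 \<sigma>\<^sub>I \<sigma>\<^sub>I\<^sub>I \<omega> =
     (LEAST n. n \<ge> 1 \<and> snd (snd (\<omega> n)) > cutoff D \<epsilon> (position p \<epsilon> q\<^sub>0 \<sigma>\<^sub>I \<sigma>\<^sub>I\<^sub>I (n - 1) \<omega>))"

definition game_regular_point :: "heis set \<Rightarrow> real \<Rightarrow> heis \<Rightarrow> bool" where
  "game_regular_point D p q\<^sub>0 \<longleftrightarrow>
     (\<forall>\<eta>>0. \<forall>\<delta>>0. \<exists>\<delta>'\<in>{0<..<\<delta>}. \<exists>\<epsilon>'\<in>{0<..<1}. \<forall>\<epsilon>\<in>{0<..<\<epsilon>'}. \<forall>p\<^sub>0\<in>hball q\<^sub>0 \<delta>'.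
        \<exists>\<sigma>\<^sub>I. strategy \<sigma>\<^sub>I \<and> (\<forall>\<sigma>\<^sub>I\<^sub>I. strategy \<sigma>\<^sub>I\<^sub>I \<longrightarrow>
          measure game_space {\<omega> \<in> space game_space.
            position p \<epsilon> p\<^sub>0 \<sigma>\<^sub>I \<sigma>\<^sub>I\<^sub>I (stop_time D p \<epsilon> p\<^sub>0 \<sigma>\<^sub>I \<sigma>\<^sub>I\<^sub>I \<omega> - 1) \<omega> \<in> hball q\<^sub>0 \<delta>} \<ge> 1 - \<eta>))"

definition game_regular :: "heis set \<Rightarrow> real \<Rightarrow> bool" where
  "game_regular D p \<longleftrightarrow> (\<forall>q\<^sub>0\<in>frontier D. game_regular_point D p q\<^sub>0)"

end

theory Submission
  imports Defs
begin

text \<open>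
  Take \<open>F q = - min 1 (hdist q\<^sub>0 q)\<close>. Player I who, at each step, nearly realises the supremum in the
  dynamic programming principle, with summable errors, turns \<open>u\<^sub>\<epsilon>\<close> along the game into a
  submartingale up to these errors, whatever Player II does; hence \<open>u\<^sub>\<epsilon> p\<^sub>0\<close> is almost a lower bound of
  the expectation of \<open>F\<close> at the final position. As \<open>u\<^sub>\<epsilon> q\<^sub>0 = F q\<^sub>0 = 0\<close>, equicontinuity makes \<open>u\<^sub>\<epsilon> p\<^sub>0\<close>
  almost nonnegative for \<open>p\<^sub>0\<close> near \<open>q\<^sub>0\<close>, and Markov's inequality bounds the probability of ending
  far from \<open>q\<^sub>0\<close>. The same exponential weight makes the Picard iteration for \<open>u\<^sub>\<epsilon>\<close> converge and
  shows that the game ends almost surely.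
\<close>

section \<open>The Koranyi gauge and its balls\<close>

text \<open>The hypothesis speaks of solutions of the dynamic programming principle that are already
  given, so it can be applied to the chosen \<open>F\<close> only once a family \<open>u\<close> has
  been constructed; this is why much of the work is an existence proof. The obstacle there and in
  the termination of the game is the same: inside \<open>D\<close> the cutoff may equal 1, so
  averaging is merely nonexpansive in the sup norm, and two of its three terms are taken at points
  selected by an infimum and a supremum or by the players. Only the unbiased third is out of their
  reach, and the weight must draw its whole gain from that third. Two features of the game shape the
  rest. Supremum over an open ball need not be attained and a strategy must be measurable, so
  near-optimal moves are selected from a countable dense set. The martingale argument needs no
  conditional expectations: positions and survival up to round \<open>n\<close> ignore outcome
  \<open>n + 1\<close>, so it is enough to integrate over a fresh copy of that single
  coordinate.\<close>

lemma hmult_eq: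
  "a \<odot> b = (fst a + fst b, fst (snd a) + fst (snd b),
     snd (snd a) + snd (snd b) + (fst a * fst (snd b) - fst (snd a) * fst b) / 2)"
  by (cases a; cases b) simp

lemma hdilate_eq: "hdilate l q = (l * fst q, l * fst (snd q), l\<^sup>2 * snd (snd q))"
  by (cases q) simp

lemma koranyi_gauge_eq:
  "koranyi_gauge q = root 4 (((fst q)\<^sup>2 + (fst (snd q))\<^sup>2)\<^sup>2 + 16 * (snd (snd q))\<^sup>2)"
  by (cases q) simp

lemma continuous_on_hmult [continuous_intros]:
  fixes f g :: "'a::topological_space \<Rightarrow> heis"
  assumes "continuous_on S f" "continuous_on S g"
  shows "continuous_on S (\<lambda>x. f x \<odot> g x)"
  unfolding hmult_eq by (intro continuous_intros assms) auto

lemma continuous_on_hdilate [continuous_intros]: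
  fixes f :: "'a::topological_space \<Rightarrow> heis"
  assumes "continuous_on S f"
  shows "continuous_on S (\<lambda>x. hdilate l (f x))"
  unfolding hdilate_eq by (intro continuous_intros assms)

lemma continuous_on_koranyi_gauge [continuous_intros]:
  fixes f :: "'a::topological_space \<Rightarrow> heis"
  assumes "continuous_on S f"
  shows "continuous_on S (\<lambda>x. koranyi_gauge (f x))"
  unfolding koranyi_gauge_eq by (intro continuous_intros assms)

lemma continuous_on_hdist [continuous_intros]:
  fixes f g :: "'a::topological_space \<Rightarrow> heis"
  assumes "continuous_on S f" "continuous_on S g"
  shows "continuous_on S (\<lambda>x. hdist (f x) (g x))"
  unfolding hdist_def hinv_def by (intro continuous_intros assms)

lemma koranyi_gauge_nonneg [simp]: "0 \<le> koranyi_gauge q"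
  unfolding koranyi_gauge_eq by simp

lemma koranyi_gauge_zero [simp]: "koranyi_gauge 0 = 0"
  unfolding koranyi_gauge_eq by simp

lemma koranyi_gauge_power4:
  "koranyi_gauge q ^ 4 = ((fst q)\<^sup>2 + (fst (snd q))\<^sup>2)\<^sup>2 + 16 * (snd (snd q))\<^sup>2"
  unfolding koranyi_gauge_eq by simp

lemma hdist_nonneg [simp]: "0 \<le> hdist q q'"
  unfolding hdist_def by simp

lemma hdist_self [simp]: "hdist q q = 0"
  unfolding hdist_def by simp

lemma hdist_hmult [simp]: "hdist q (q \<odot> w) = koranyi_gauge w"
  unfolding hdist_def by (simp flip: hmult_assoc)

lemma koranyi_gauge_hdilate:
  assumes "0 \<le> l"
  shows "koranyi_gauge (hdilate l q) = l * koranyi_gauge q"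
proof -
  have "koranyi_gauge (hdilate l q) ^ 4 = (l * koranyi_gauge q) ^ 4"
    unfolding power_mult_distrib koranyi_gauge_power4 hdilate_eq
    by (simp add: algebra_simps power2_eq_square power4_eq_xxxx)
  then show ?thesis
    using assms by (auto intro: power_eq_imp_eq_base[where n = 4])
qed

lemma koranyi_gauge_components:
  shows "\<bar>fst q\<bar> \<le> koranyi_gauge q" "\<bar>fst (snd q)\<bar> \<le> koranyi_gauge q"
    "4 * \<bar>snd (snd q)\<bar> \<le> (koranyi_gauge q)\<^sup>2"
proof -
  have le: "a \<le> koranyi_gauge q" if "a ^ 4 \<le> koranyi_gauge q ^ 4" for a
    using that power_mono_iff[of a "koranyi_gauge q" 4]
    by (metis koranyi_gauge_nonneg linear order.trans power_mono_iff zero_less_numeral)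
  have sq: "x ^ 4 \<le> (x\<^sup>2 + y\<^sup>2)\<^sup>2" "y ^ 4 \<le> (x\<^sup>2 + y\<^sup>2)\<^sup>2" for x y :: real
    by (simp_all add: power2_sum flip: power_mult)
  show "\<bar>fst q\<bar> \<le> koranyi_gauge q"
    by (rule le, unfold koranyi_gauge_power4 power_even_abs_numeral)
      (rule add_increasing2, simp, simp add: sq)
  show "\<bar>fst (snd q)\<bar> \<le> koranyi_gauge q"
    by (rule le, unfold koranyi_gauge_power4 power_even_abs_numeral)
      (rule add_increasing2, simp, simp add: sq)
  have "(4 * \<bar>snd (snd q)\<bar>)\<^sup>2 \<le> ((koranyi_gauge q)\<^sup>2)\<^sup>2"
    using koranyi_gauge_power4[of q] by (simp add: power_mult_distrib flip: power_mult)
  then show "4 * \<bar>snd (snd q)\<bar> \<le> (koranyi_gauge q)\<^sup>2"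
    by (rule power2_le_imp_le) simp
qed

text \<open>The vertical coordinate is of second order in the gauge, hence the square. This is the
  only passage from Koranyi size to Euclidean size.\<close>

lemma norm_le_koranyi_gauge: "norm q \<le> 2 * koranyi_gauge q + (koranyi_gauge q)\<^sup>2"
proof -
  have "norm q \<le> \<bar>fst q\<bar> + (\<bar>fst (snd q)\<bar> + \<bar>snd (snd q)\<bar>)"
    using norm_Pair_le[of "fst q" "snd q"] norm_Pair_le[of "fst (snd q)" "snd (snd q)"] by simp
  then show ?thesis
    using koranyi_gauge_components[of q] by linarith
qed

lemma mem_hball: "q' \<in> hball q r \<longleftrightarrow> hdist q q' < r"
  unfolding hball_def by simp

lemma hmult_hdilate_mem_hball:
  "r > 0 \<Longrightarrow> q \<odot> hdilate r w \<in> hball q r \<longleftrightarrow> w \<in> hball 0 1"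
  using hdist_hmult[of 0 w] by (simp add: mem_hball koranyi_gauge_hdilate)

text \<open>Left translation and dilation carry the unit ball onto every ball. Suprema over balls
  with moving centre thus become suprema over one fixed index set, the set from which players and
  noise draw.\<close>

lemma hball_eq_image:
  assumes "r > 0"
  shows "hball q r = (\<lambda>w. q \<odot> hdilate r w) ` hball 0 1"
proof (intro equalityI subsetI)
  fix q' assume q': "q' \<in> hball q r"
  have *: "hdilate r (hdilate (1 / r) x) = x" for x
    using assms by (simp add: hdilate_eq power2_eq_square)
  have "q' = q \<odot> hdilate r (hdilate (1 / r) (hinv q \<odot> q'))"
    unfolding * by (simp flip: hmult_assoc)
  then show "q' \<in> (\<lambda>w. q \<odot> hdilate r w) ` hball 0 1"
    using q' hmult_hdilate_mem_hball[OF assms] by (metis imageI)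
next
  fix q' assume "q' \<in> (\<lambda>w. q \<odot> hdilate r w) ` hball 0 1"
  then show "q' \<in> hball q r"
    using hmult_hdilate_mem_hball[OF assms] by blast
qed

lemma open_hball: "open (hball q r)"
  unfolding hball_def by (intro open_Collect_less continuous_intros)

lemma hball_borel [measurable]: "hball q r \<in> sets borel"
  by (simp add: open_hball)

lemma zero_mem_unit_hball [simp]: "0 \<in> hball 0 1"
  by (simp add: mem_hball)

lemma bounded_unit_hball: "bounded (hball 0 1)"
proof (rule boundedI)
  fix w assume "w \<in> hball 0 1"
  then have "koranyi_gauge w < 1"
    using hdist_hmult[of 0 w] by (simp add: mem_hball)
  moreover from this have "(koranyi_gauge w)\<^sup>2 \<le> 1"
    by (simp add: power_le_one)
  ultimately show "norm w \<le> 3"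
    using norm_le_koranyi_gauge[of w] by linarith
qed

text \<open>Starting points are close to the boundary point in the Koranyi sense, while
  equicontinuity is Euclidean; this lemma translates between the two.\<close>

lemma ball_contains_hball:
  assumes "e > 0"
  obtains d where "d > 0" "\<And>q'. q' \<in> hball q d \<Longrightarrow> norm (q' - q) < e"
proof -
  have "continuous_on UNIV (\<lambda>w. q \<odot> w)"
    by (intro continuous_intros)
  then have "isCont (\<lambda>w. q \<odot> w) 0"
    using continuous_on_eq_continuous_at open_UNIV by blast
  then obtain s where s: "s > 0" "\<And>w. norm w < s \<Longrightarrow> norm (q \<odot> w - q) < e"
    using assms unfolding continuous_at_eps_delta by (auto simp: dist_norm simp del: split_paired_All)
  \<comment> \<open>For a gauge below 1 the square is at most the gauge itself, so the norm is at
    most three times the gauge.\<close>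
  define d where "d = min 1 (s / 3)"
  show thesis
  proof (rule that[of d])
    show "d > 0" using s(1) by (simp add: d_def)
    fix q' assume "q' \<in> hball q d"
    define w where "w = hinv q \<odot> q'"
    have q': "q' = q \<odot> w" unfolding w_def by (simp flip: hmult_assoc)
    have g: "koranyi_gauge w < d" using \<open>q' \<in> hball q d\<close> unfolding q' mem_hball by simp
    have "(koranyi_gauge w)\<^sup>2 \<le> koranyi_gauge w"
      using g unfolding power2_eq_square d_def by (intro mult_left_le) auto
    then have "norm w < s"
      using norm_le_koranyi_gauge[of w] g unfolding d_def by linarith
    then show "norm (q' - q) < e" unfolding q' by (rule s(2))
  qed
qed

section \<open>Averages over Koranyi balls\<close>

lemma nn_integral_lborel_heis:
  fixes f :: "heis \<Rightarrow> ennreal"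
  assumes [measurable]: "f \<in> borel_measurable borel"
  shows "(\<integral>\<^sup>+w. f w \<partial>lborel) = (\<integral>\<^sup>+a. \<integral>\<^sup>+b. \<integral>\<^sup>+c. f (a, b, c) \<partial>lborel \<partial>lborel \<partial>lborel)"
proof -
  have "(\<integral>\<^sup>+w. f w \<partial>lborel) = (\<integral>\<^sup>+w. f w \<partial>(lborel \<Otimes>\<^sub>M lborel))"
    by (simp only: lborel_prod)
  also have "\<dots> = (\<integral>\<^sup>+a. \<integral>\<^sup>+u. f (a, u) \<partial>lborel \<partial>lborel)"
    by (intro lborel.nn_integral_fst[symmetric]) (simp add: lborel_prod)
  also have "\<dots> = (\<integral>\<^sup>+a. \<integral>\<^sup>+u. f (a, u) \<partial>(lborel \<Otimes>\<^sub>M lborel) \<partial>lborel)"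
    by (simp only: lborel_prod)
  also have "\<dots> = (\<integral>\<^sup>+a. \<integral>\<^sup>+b. \<integral>\<^sup>+c. f (a, b, c) \<partial>lborel \<partial>lborel \<partial>lborel)"
    by (intro nn_integral_cong lborel.nn_integral_fst[symmetric]) (simp add: lborel_prod)
  finally show ?thesis .
qed

text \<open>Left translation adds to \<open>z\<close> a shear that is constant in \<open>z\<close>,
  so integrating over \<open>z\<close> first removes it; the dilation then contributes r in each
  horizontal direction and the square of r vertically, which gives the homogeneous dimension
  4.\<close>

lemma nn_integral_hmult_hdilate:
  assumes r: "r > 0" and [measurable]: "f \<in> borel_measurable borel"
  shows "(\<integral>\<^sup>+w. f w \<partial>lborel) = ennreal (r ^ 4) * (\<integral>\<^sup>+w. f (q \<odot> hdilate r w) \<partial>lborel)"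
proof -
  obtain x y z where q: "q = (x, y, z)" by (cases q)
  have [measurable]: "f \<in> borel_measurable (borel \<Otimes>\<^sub>M borel \<Otimes>\<^sub>M borel)"
    by (simp add: borel_prod)
  \<comment> \<open>The shift \<open>t\<close> is left free because it will later absorb the group
    term, which depends on the outer variables.\<close>
  have c: "(\<integral>\<^sup>+c. f (a, b, c) \<partial>lborel) = r\<^sup>2 * (\<integral>\<^sup>+c. f (a, b, t + r\<^sup>2 * c) \<partial>lborel)" for a b t
    using nn_integral_real_affine[of "\<lambda>c. f (a, b, c)" "r\<^sup>2" t] r by simp
  have b: "(\<integral>\<^sup>+b. \<integral>\<^sup>+c. f (a, b, c) \<partial>lborel \<partial>lborel)
      = r ^ 3 * (\<integral>\<^sup>+b. \<integral>\<^sup>+c. f (a, y + r * b, t b + r\<^sup>2 * c) \<partial>lborel \<partial>lborel)"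
    if [measurable]: "t \<in> borel_measurable borel" for a t
  proof -
    have "(\<integral>\<^sup>+b. \<integral>\<^sup>+c. f (a, b, c) \<partial>lborel \<partial>lborel)
      = r * (\<integral>\<^sup>+b. \<integral>\<^sup>+c. f (a, y + r * b, c) \<partial>lborel \<partial>lborel)"
      using nn_integral_real_affine[of "\<lambda>b. \<integral>\<^sup>+c. f (a, b, c) \<partial>lborel" r y] r by simp
    also have "\<dots> = r * (\<integral>\<^sup>+b. r\<^sup>2 * (\<integral>\<^sup>+c. f (a, y + r * b, t b + r\<^sup>2 * c) \<partial>lborel) \<partial>lborel)"
      by (intro arg_cong2[where f = "(*)"] refl nn_integral_cong c)
    also have "\<dots> = r * (r\<^sup>2 * (\<integral>\<^sup>+b. \<integral>\<^sup>+c. f (a, y + r * b, t b + r\<^sup>2 * c) \<partial>lborel \<partial>lborel))"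
      by (subst nn_integral_cmult) simp_all
    finally show ?thesis
      using r by (simp add: power2_eq_square power3_eq_cube ennreal_mult mult.assoc)
  qed
  let ?g = "\<lambda>a. \<integral>\<^sup>+b. \<integral>\<^sup>+c. f (x + r * a, y + r * b, z + (x * (r * b) - y * (r * a)) / 2 + r\<^sup>2 * c) \<partial>lborel \<partial>lborel"
  have "(\<integral>\<^sup>+w. f w \<partial>lborel) = (\<integral>\<^sup>+a. \<integral>\<^sup>+b. \<integral>\<^sup>+c. f (a, b, c) \<partial>lborel \<partial>lborel \<partial>lborel)"
    by (rule nn_integral_lborel_heis) simp
  also have "\<dots> = r * (\<integral>\<^sup>+a. \<integral>\<^sup>+b. \<integral>\<^sup>+c. f (x + r * a, b, c) \<partial>lborel \<partial>lborel \<partial>lborel)"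
    using nn_integral_real_affine[of "\<lambda>a. \<integral>\<^sup>+b. \<integral>\<^sup>+c. f (a, b, c) \<partial>lborel \<partial>lborel" r x] r by simp
  also have "\<dots> = r * (\<integral>\<^sup>+a. r ^ 3 * ?g a \<partial>lborel)"
    by (intro arg_cong2[where f = "(*)"] refl nn_integral_cong b) simp_all
  also have "\<dots> = r * (r ^ 3 * (\<integral>\<^sup>+a. ?g a \<partial>lborel))"
    by (subst nn_integral_cmult) simp_all
  also have "\<dots> = r ^ 4 * (\<integral>\<^sup>+a. ?g a \<partial>lborel)"
    using r by (simp add: eval_nat_numeral ennreal_mult mult.assoc)
  also have "(\<integral>\<^sup>+a. ?g a \<partial>lborel) = (\<integral>\<^sup>+w. f (q \<odot> hdilate r w) \<partial>lborel)"
  proof -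
    have "(\<lambda>w. q \<odot> hdilate r w) \<in> borel_measurable borel"
      by (intro borel_measurable_continuous_onI continuous_intros)
    then have "(\<lambda>w. f (q \<odot> hdilate r w)) \<in> borel_measurable borel"
      by simp
    then show ?thesis
      by (subst nn_integral_lborel_heis) (simp_all add: q algebra_simps)
  qed
  finally show ?thesis .
qed

section \<open>Averages as expectations over the noise\<close>

definition noise :: "heis measure" where
  "noise = restrict_space (uniform_measure lborel (hball 0 1)) (hball 0 1)"

lemma space_noise [simp]: "space noise = hball 0 1"
  by (simp add: noise_def space_restrict_space)

lemma sets_noise: "sets noise = sets (restrict_space borel (hball 0 1))"
  unfolding noise_def by (intro sets_restrict_space_cong) simp

lemma measurable_noiseI [measurable (raw)]:
  "f \<in> borel_measurable borel \<Longrightarrow> f \<in> borel_measurable noise"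
  by (subst measurable_cong_sets[OF sets_noise refl]) (rule measurable_restrict_space1)

lemma emeasure_lborel_unit_hball:
  "emeasure lborel (hball 0 1) \<noteq> 0" "emeasure lborel (hball 0 1) < \<infinity>"
proof -
  show "emeasure lborel (hball 0 1) < \<infinity>"
    by (rule emeasure_bounded_finite) (rule bounded_unit_hball)
  have "\<not> negligible (hball 0 1)"
    by (rule open_not_negligible) (use open_hball zero_mem_unit_hball in blast)+
  then show "emeasure lborel (hball 0 1) \<noteq> 0"
    by (auto simp: negligible_iff_null_sets null_sets_def null_sets_completion_iff)
qed

lemma measure_lborel_unit_hball: "measure lborel (hball 0 1) > 0"
  using emeasure_lborel_unit_hball
  by (simp add: measure_def enn2real_positive_iff zero_less_iff_neq_zero)

lemma prob_space_noise: "prob_space noise"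
proof -
  interpret prob_space "uniform_measure lborel (hball 0 1)"
    by (rule prob_space_uniform_measure) (use emeasure_lborel_unit_hball in auto)
  show ?thesis
    unfolding noise_def
    by (rule prob_space_restrict_space)
      (use emeasure_lborel_unit_hball in \<open>auto simp: emeasure_uniform_measure\<close>)
qed

interpretation noise: prob_space noise
  by (rule prob_space_noise)

lemma integral_noise:
  fixes f :: "heis \<Rightarrow> real"
  assumes [measurable]: "f \<in> borel_measurable borel"
  shows "(\<integral>w. f w \<partial>noise) = (LINT w:hball 0 1|lborel. f w) / measure lborel (hball 0 1)"
proof -
  let ?B = "hball 0 1"
  have "(\<integral>w. f w \<partial>noise) = (\<integral>w. indicator ?B w *\<^sub>R f w \<partial>uniform_measure lborel ?B)"
    unfolding noise_def by (rule integral_restrict_space) simp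
  also have "uniform_measure lborel ?B = density lborel (\<lambda>w. ennreal (indicator ?B w / measure lborel ?B))"
    unfolding uniform_measure_def
    by (intro density_cong AE_I2)
      (use emeasure_lborel_unit_hball measure_lborel_unit_hball in
       \<open>auto simp: indicator_def measure_def ennreal_enn2real_if divide_ennreal[symmetric] enn2real_positive_iff less_top\<close>)
  also have "(\<integral>w. indicator ?B w *\<^sub>R f w \<partial>\<dots>) = (\<integral>w. (indicator ?B w *\<^sub>R f w) / measure lborel ?B \<partial>lborel)"
    by (subst integral_density) (auto intro!: Bochner_Integration.integral_cong simp: indicator_def)
  finally show ?thesis
    by (simp add: set_lebesgue_integral_def)
qed

lemma measurable_hmult_hdilate [measurable]: "(\<lambda>w. q \<odot> hdilate r w) \<in> borel_measurable borel"
  by (intro borel_measurable_continuous_onI continuous_intros)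

lemma integral_hmult_hdilate:
  fixes f :: "heis \<Rightarrow> real"
  assumes "r > 0" and [measurable]: "f \<in> borel_measurable borel"
  shows "(\<integral>w. f w \<partial>lborel) = r ^ 4 * (\<integral>w. f (q \<odot> hdilate r w) \<partial>lborel)"
proof -
  let ?T = "\<lambda>w. q \<odot> hdilate r w"
  have "lborel = density (distr lborel borel ?T) (\<lambda>_. ennreal (r ^ 4))"
  proof (rule measure_eqI)
    fix A :: "heis set" assume "A \<in> sets lborel"
    then have [measurable]: "A \<in> sets borel" by simp
    have "emeasure lborel A = (\<integral>\<^sup>+w. indicator A w \<partial>lborel)"
      by simp
    also have "\<dots> = ennreal (r ^ 4) * (\<integral>\<^sup>+w. indicator A (?T w) \<partial>lborel)"
      by (rule nn_integral_hmult_hdilate[OF assms(1)]) simp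
    also have "\<dots> = emeasure (density (distr lborel borel ?T) (\<lambda>_. ennreal (r ^ 4))) A"
      by (subst emeasure_density) (simp_all add: nn_integral_cmult nn_integral_distr del: nn_integral_indicator)
    finally show "emeasure lborel A = \<dots>" .
  qed simp
  then have "(\<integral>w. f w \<partial>lborel) = (\<integral>w. f w \<partial>density (distr lborel borel ?T) (\<lambda>_. ennreal (r ^ 4)))"
    by simp
  also have "\<dots> = r ^ 4 * (\<integral>w. f (?T w) \<partial>lborel)"
    using assms(1) by (simp add: integral_density integral_distr)
  finally show ?thesis .
qed

text \<open>Substitute \<open>q \<odot> hdilate r w\<close> for the integration variable: integral
  and volume both pick up r to the fourth power, which cancels. The centre moves from the domain of
  integration into the integrand.\<close>

lemma havg_eq:
  assumes r: "r > 0" and [measurable]: "v \<in> borel_measurable borel"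
  shows "havg v r q = (\<integral>w. v (q \<odot> hdilate r w) \<partial>noise)"
proof -
  let ?T = "\<lambda>w. q \<odot> hdilate r w"
  have ind: "indicator (hball q r) (?T w) = (indicator (hball 0 1) w :: real)" for w
    using hmult_hdilate_mem_hball[OF r, of q w] by (simp add: indicator_def)
  have "(LINT w:hball q r|lborel. v w) = r ^ 4 * (LINT w:hball 0 1|lborel. v (?T w))"
    unfolding set_lebesgue_integral_def
    by (subst integral_hmult_hdilate[OF r, where q = q]) (simp_all add: ind)
  moreover have "measure lborel (hball q r) = r ^ 4 * measure lborel (hball 0 1)"
    using integral_hmult_hdilate[OF r, of "indicator (hball q r)" q] by (simp add: ind)
  ultimately show ?thesis
    using r by (simp add: havg_def integral_noise)
qed

lemma integrable_noise:
  fixes v :: "heis \<Rightarrow> real"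
  assumes "v \<in> borel_measurable borel" "\<And>q. \<bar>v q\<bar> \<le> C"
  shows "integrable noise (\<lambda>w. v (q \<odot> hdilate r w))"
  using assms by (intro noise.integrable_const_bound[where B = C] AE_I2) auto

lemma havg_abs_le:
  assumes "r > 0" "v \<in> borel_measurable borel" "\<And>q. \<bar>v q\<bar> \<le> C"
  shows "\<bar>havg v r q\<bar> \<le> C"
proof -
  have "\<bar>\<integral>w. v (q \<odot> hdilate r w) \<partial>noise\<bar> \<le> (\<integral>w. C \<partial>noise)"
    using integrable_noise[OF assms(2,3)] assms(3)
    by (intro integral_abs_bound_integral) auto
  then show ?thesis
    using noise.prob_space by (simp add: havg_eq assms)
qed

lemma havg_mono:
  assumes "r > 0" "u \<in> borel_measurable borel" "\<And>q. \<bar>u q\<bar> \<le> C"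
    "v \<in> borel_measurable borel" "\<And>q. \<bar>v q\<bar> \<le> C'" "\<And>q'. q' \<in> hball q r \<Longrightarrow> u q' \<le> v q'"
  shows "havg u r q \<le> havg v r q"
  unfolding havg_eq[OF assms(1,2)] havg_eq[OF assms(1,4)]
  using integrable_noise[OF assms(2,3)] integrable_noise[OF assms(4,5)] assms(6)
    hmult_hdilate_mem_hball[OF assms(1)]
  by (intro integral_mono) auto

lemma havg_diff:
  assumes "r > 0" "u \<in> borel_measurable borel" "\<And>q. \<bar>u q\<bar> \<le> C"
    "v \<in> borel_measurable borel" "\<And>q. \<bar>v q\<bar> \<le> C'"
  shows "havg (\<lambda>q. u q - v q) r q = havg u r q - havg v r q"
proof -
  have "(\<lambda>q. u q - v q) \<in> borel_measurable borel"
    using assms by simp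
  then show ?thesis
    using assms Bochner_Integration.integral_diff[OF integrable_noise[OF assms(2,3)] integrable_noise[OF assms(4,5)]]
    by (simp add: havg_eq)
qed

text \<open>With the centre inside the integrand this is dominated convergence, the bound
  \<open>C\<close> being integrable for the probability measure \<open>noise\<close>.\<close>

lemma continuous_on_havg:
  assumes r: "r > 0" and v: "continuous_on UNIV v" and C: "\<And>q. \<bar>v q\<bar> \<le> C"
  shows "continuous_on UNIV (havg v r)"
proof -
  have [measurable]: "v \<in> borel_measurable borel"
    using v by (rule borel_measurable_continuous_onI)
  have "continuous (at q) (havg v r)" for q
    unfolding continuous_at_sequentially
  proof (intro allI impI)
    fix X assume X: "X \<longlonglongrightarrow> q"
    have "(\<lambda>n. \<integral>w. v (X n \<odot> hdilate r w) \<partial>noise) \<longlonglongrightarrow> (\<integral>w. v (q \<odot> hdilate r w) \<partial>noise)"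
    proof (rule integral_dominated_convergence[where w = "\<lambda>_. C"])
      show "AE w in noise. (\<lambda>n. v (X n \<odot> hdilate r w)) \<longlonglongrightarrow> v (q \<odot> hdilate r w)"
      proof (rule AE_I2)
        fix w
        have "continuous_on UNIV (\<lambda>q. v (q \<odot> hdilate r w))"
          by (intro continuous_on_compose2[OF v] continuous_intros) simp
        then show "(\<lambda>n. v (X n \<odot> hdilate r w)) \<longlonglongrightarrow> v (q \<odot> hdilate r w)"
          using X by (intro continuous_on_tendsto_compose[of UNIV "\<lambda>q. v (q \<odot> hdilate r w)"]) auto
      qed
    qed (use C in auto)
    then show "(havg v r \<circ> X) \<longlonglongrightarrow> havg v r q"
      by (simp add: havg_eq r comp_def)
  qed
  then show ?thesis
    by (simp add: continuous_at_imp_continuous_on)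
qed

section \<open>Suprema over bounded sets and the cutoff\<close>

lemma abs_SUP_diff_le:
  fixes f g :: "'a \<Rightarrow> real"
  assumes "K \<noteq> {}" "bdd_above (f ` K)" "bdd_above (g ` K)" "\<And>w. w \<in> K \<Longrightarrow> \<bar>f w - g w\<bar> \<le> e"
  shows "\<bar>(SUP w\<in>K. f w) - (SUP w\<in>K. g w)\<bar> \<le> e"
proof -
  have "(SUP w\<in>K. f w) \<le> (SUP w\<in>K. g w) + e"
  proof (rule cSUP_least[OF assms(1)])
    fix w assume "w \<in> K"
    then show "f w \<le> (SUP w\<in>K. g w) + e"
      using assms(4)[of w] cSUP_upper[OF _ assms(3), of w] by linarith
  qed
  moreover have "(SUP w\<in>K. g w) \<le> (SUP w\<in>K. f w) + e"
  proof (rule cSUP_least[OF assms(1)])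
    fix w assume "w \<in> K"
    then show "g w \<le> (SUP w\<in>K. f w) + e"
      using assms(4)[of w] cSUP_upper[OF _ assms(2), of w] by linarith
  qed
  ultimately show ?thesis by linarith
qed

lemma INF_eq_uminus_SUP:
  fixes f :: "'a \<Rightarrow> real"
  shows "(INF w\<in>K. f w) = - (SUP w\<in>K. - f w)"
  by (simp add: Inf_real_def image_image)

lemma abs_INF_diff_le:
  fixes f g :: "'a \<Rightarrow> real"
  assumes "K \<noteq> {}" "bdd_below (f ` K)" "bdd_below (g ` K)" "\<And>w. w \<in> K \<Longrightarrow> \<bar>f w - g w\<bar> \<le> e"
  shows "\<bar>(INF w\<in>K. f w) - (INF w\<in>K. g w)\<bar> \<le> e"
proof -
  have "\<bar>(SUP w\<in>K. - f w) - (SUP w\<in>K. - g w)\<bar> \<le> e"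
  proof (rule abs_SUP_diff_le)
    show "bdd_above ((\<lambda>w. - f w) ` K)" "bdd_above ((\<lambda>w. - g w) ` K)"
      using assms(2,3) bdd_above_uminus[of "f ` K"] bdd_above_uminus[of "g ` K"] by (simp_all add: image_image)
    show "\<bar>- f w - - g w\<bar> \<le> e" if "w \<in> K" for w
      using assms(4)[OF that] by linarith
  qed (rule assms)
  then show ?thesis
    unfolding INF_eq_uminus_SUP by linarith
qed

text \<open>\<open>K\<close> is only bounded, so the supremum may be missed; but uniform continuity
  on the compact set \<open>cball q 1 \<times> closure K\<close> moves all values
  \<open>h q w\<close> by at most e / 2 at once, and the supremum with them.\<close>

lemma continuous_on_SUP:
  fixes h :: "heis \<Rightarrow> heis \<Rightarrow> real"
  assumes h: "continuous_on UNIV (\<lambda>x. h (fst x) (snd x))" and K: "bounded K" "K \<noteq> {}"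
  shows "continuous_on UNIV (\<lambda>q. SUP w\<in>K. h q w)"
proof -
  have bdd: "bdd_above (h q ` K)" for q
  proof -
    have "continuous_on (closure K) (h q)"
      using continuous_on_compose2[OF h, of "closure K" "\<lambda>w. (q, w)"] by (simp add: continuous_on_Pair)
    then have "compact (h q ` closure K)"
      using K by (simp add: compact_continuous_image compact_closure)
    then have "bdd_above (h q ` closure K)"
      by (simp add: bounded_imp_bdd_above compact_imp_bounded)
    then show ?thesis
      by (rule bdd_above_mono) (simp add: closure_subset image_mono)
  qed
  have "\<exists>d>0. \<forall>q'. dist q' q < d \<longrightarrow> dist (SUP w\<in>K. h q' w) (SUP w\<in>K. h q w) < e" if "e > 0" for e q
  proof -
    have "compact (cball q 1 \<times> closure K)"
      using K by (simp add: compact_Times compact_closure)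
    then have "uniformly_continuous_on (cball q 1 \<times> closure K) (\<lambda>x. h (fst x) (snd x))"
      using compact_uniformly_continuous continuous_on_subset[OF h subset_UNIV] by blast
    then obtain d where d: "d > 0" "\<And>x y. x \<in> cball q 1 \<times> closure K \<Longrightarrow> y \<in> cball q 1 \<times> closure K \<Longrightarrow>
        dist x y < d \<Longrightarrow> dist (h (fst x) (snd x)) (h (fst y) (snd y)) < e / 2"
      using \<open>e > 0\<close> unfolding uniformly_continuous_on_def by (metis half_gt_zero dist_commute)
    have "dist (SUP w\<in>K. h q' w) (SUP w\<in>K. h q w) < e" if q': "dist q' q < min d 1" for q'
    proof -
      have "\<bar>h q' w - h q w\<bar> \<le> e / 2" if "w \<in> K" for w
      proof -
        have "w \<in> closure K" using that closure_subset by blast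
        then show ?thesis
          using d(2)[of "(q', w)" "(q, w)"] q' by (simp add: dist_Pair_Pair dist_commute dist_real_def)
      qed
      then have "\<bar>(SUP w\<in>K. h q' w) - (SUP w\<in>K. h q w)\<bar> \<le> e / 2"
        by (intro abs_SUP_diff_le K bdd)
      then show ?thesis
        using \<open>e > 0\<close> by (simp add: dist_real_def)
    qed
    then show ?thesis
      using d(1) by (metis min_less_iff_conj zero_less_one)
  qed
  then show ?thesis
    unfolding continuous_on_iff by blast
qed

lemma continuous_on_INF:
  fixes h :: "heis \<Rightarrow> heis \<Rightarrow> real"
  assumes h: "continuous_on UNIV (\<lambda>x. h (fst x) (snd x))" and K: "bounded K" "K \<noteq> {}"
  shows "continuous_on UNIV (\<lambda>q. INF w\<in>K. h q w)"
  unfolding INF_eq_uminus_SUP using h K by (intro continuous_on_minus continuous_on_SUP)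

section \<open>The cutoff near and away from the complement of \<open>D\<close>\<close>

lemma cutoff_eq_0:
  assumes "\<epsilon> > 0" "q \<notin> D"
  shows "cutoff D \<epsilon> q = 0"
proof -
  have "(INF q'\<in>- D. hdist q q') \<le> hdist q q"
    using assms by (intro cINF_lower bdd_belowI2[of _ 0]) auto
  moreover have "0 \<le> (INF q'\<in>- D. hdist q q')"
    using assms by (intro cINF_greatest) auto
  ultimately show ?thesis
    using assms by (simp add: cutoff_def)
qed

lemma cutoff_bounds:
  assumes "\<epsilon> > 0" "- D \<noteq> {}"
  shows "0 \<le> cutoff D \<epsilon> q" "cutoff D \<epsilon> q \<le> 1"
proof -
  have "0 \<le> (INF q'\<in>- D. hdist q q')"
    using assms by (intro cINF_greatest) auto
  then show "0 \<le> cutoff D \<epsilon> q" "cutoff D \<epsilon> q \<le> 1"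
    using assms by (simp_all add: cutoff_def)
qed

text \<open>The complement of \<open>D\<close> is unbounded, but the truncation at \<epsilon> makes
  all points at distance at least \<epsilon> equivalent. Only a compact set of competitors remains,
  on which \<open>hdist\<close> is uniformly continuous.\<close>

lemma continuous_on_cutoff:
  assumes \<epsilon>: "\<epsilon> > 0" and D: "- D \<noteq> {}"
  shows "continuous_on UNIV (cutoff D \<epsilon>)"
proof -
  have "\<exists>d>0. \<forall>q'. dist q' q < d \<longrightarrow>
      dist (min \<epsilon> (INF x\<in>- D. hdist q' x)) (min \<epsilon> (INF x\<in>- D. hdist q x)) < e" if "e > 0" for e q
  proof -
    \<comment> \<open>This compact set contains \<open>hball q' \<epsilon>\<close> for every
      \<open>q'\<close> within Euclidean distance 1 of \<open>q\<close>.\<close>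
    define K where "K = (\<lambda>x. fst x \<odot> hdilate \<epsilon> (snd x)) ` (cball q 1 \<times> closure (hball 0 1))"
    have "compact K"
      unfolding K_def using bounded_unit_hball
      by (intro compact_continuous_image compact_Times continuous_intros) (simp_all add: compact_closure)
    then have "compact (cball q 1 \<times> K)"
      by (simp add: compact_Times)
    moreover have "continuous_on (cball q 1 \<times> K) (\<lambda>x. hdist (fst x) (snd x))"
      by (intro continuous_intros)
    ultimately have "uniformly_continuous_on (cball q 1 \<times> K) (\<lambda>x. hdist (fst x) (snd x))"
      using compact_uniformly_continuous by blast
    then obtain d where d: "d > 0" "\<And>x y. x \<in> cball q 1 \<times> K \<Longrightarrow> y \<in> cball q 1 \<times> K \<Longrightarrow>
        dist x y < d \<Longrightarrow> dist (hdist (fst x) (snd x)) (hdist (fst y) (snd y)) < e / 2"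
      using \<open>e > 0\<close> unfolding uniformly_continuous_on_def by (metis half_gt_zero dist_commute)
    have far: "\<epsilon> \<le> hdist q' x" if "q' \<in> cball q 1" "x \<notin> K" for q' x
    proof (rule ccontr)
      assume "\<not> \<epsilon> \<le> hdist q' x"
      then have "x \<in> hball q' \<epsilon>"
        by (simp add: mem_hball)
      then obtain w where "w \<in> hball 0 1" "x = q' \<odot> hdilate \<epsilon> w"
        using hball_eq_image[OF \<epsilon>] by blast
      then have "x \<in> K"
        unfolding K_def using that(1) closure_subset by (intro image_eqI[of _ _ "(q', w)"]) auto
      with that show False by blast
    qed
    have "dist (min \<epsilon> (INF x\<in>- D. hdist q' x)) (min \<epsilon> (INF x\<in>- D. hdist q x)) < e"
      if q': "dist q' q < min d 1" for q'
    proof -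
      have close: "\<bar>min \<epsilon> (hdist q' x) - min \<epsilon> (hdist q x)\<bar> \<le> e / 2" for x
      proof (cases "x \<in> K")
        case True
        then have "\<bar>hdist q' x - hdist q x\<bar> < e / 2"
          using d(2)[of "(q', x)" "(q, x)"] q' by (simp add: dist_Pair_Pair dist_commute dist_real_def)
        then show ?thesis by linarith
      next
        case False
        then show ?thesis
          using far[of q' x] far[of q x] q' \<open>e > 0\<close> by (simp add: dist_commute)
      qed
      \<comment> \<open>Stated for arbitrary \<open>a\<close> and \<open>b\<close> so that it can be
        used in both directions between \<open>q\<close> and \<open>q'\<close>.\<close>
      have le: "min \<epsilon> (INF x\<in>- D. hdist a x) \<le> (INF x\<in>- D. hdist b x) + e / 2"
        if ab: "\<And>x. min \<epsilon> (hdist a x) \<le> min \<epsilon> (hdist b x) + e / 2" for a b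
      proof -
        have "min \<epsilon> (INF x\<in>- D. hdist a x) - e / 2 \<le> (INF x\<in>- D. hdist b x)"
        proof (rule cINF_greatest[OF D])
          fix x assume "x \<in> - D"
          then have "(INF x\<in>- D. hdist a x) \<le> hdist a x"
            by (intro cINF_lower bdd_belowI2[of _ 0]) auto
          then show "min \<epsilon> (INF x\<in>- D. hdist a x) - e / 2 \<le> hdist b x"
            using ab[of x] by linarith
        qed
        then show ?thesis by linarith
      qed
      have "min \<epsilon> (hdist q' x) \<le> min \<epsilon> (hdist q x) + e / 2" "min \<epsilon> (hdist q x) \<le> min \<epsilon> (hdist q' x) + e / 2" for x
        using close[of x] by linarith+
      from le[OF this(1)] le[OF this(2)] show ?thesis
        using \<open>e > 0\<close> unfolding dist_real_def by linarith
    qed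
    then show ?thesis
      using d(1) by (metis min_less_iff_conj zero_less_one)
  qed
  then have "continuous_on UNIV (\<lambda>q. min \<epsilon> (INF x\<in>- D. hdist q x))"
    unfolding continuous_on_iff by blast
  then show ?thesis
    unfolding cutoff_def using \<epsilon> by (intro continuous_on_divide continuous_on_const) auto
qed

section \<open>Solutions of the dynamic programming principle\<close>

definition dpp_mean :: "real \<Rightarrow> real \<Rightarrow> (heis \<Rightarrow> real) \<Rightarrow> heis \<Rightarrow> real" where
  "dpp_mean r \<epsilon> v q = 1/3 * havg v \<epsilon> q + 1/3 * (INF q'\<in>hball q r. havg v \<epsilon> q')
     + 1/3 * (SUP q'\<in>hball q r. havg v \<epsilon> q')"

lemma dpp_solution_iff:
  "dpp_solution D p F \<epsilon> u \<longleftrightarrow> continuous_on UNIV u \<and> bounded (range u) \<and>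
     (\<forall>q. u q = cutoff D \<epsilon> q * dpp_mean (gamma_p p * \<epsilon>) \<epsilon> u q + (1 - cutoff D \<epsilon> q) * F q)"
  unfolding dpp_solution_def dpp_mean_def ..

lemma hball_ne: "r > 0 \<Longrightarrow> hball q r \<noteq> {}"
  using mem_hball[of q q r] by auto

lemma bdd_havg:
  assumes "\<epsilon> > 0" "v \<in> borel_measurable borel" "\<And>q. \<bar>v q\<bar> \<le> C"
  shows "bdd_above (havg v \<epsilon> ` K)" "bdd_below (havg v \<epsilon> ` K)"
proof -
  have "\<bar>havg v \<epsilon> q\<bar> \<le> C" for q
    by (rule havg_abs_le) (rule assms)+
  then show "bdd_above (havg v \<epsilon> ` K)" "bdd_below (havg v \<epsilon> ` K)"
    by (auto intro!: bdd_aboveI2[of _ _ C] bdd_belowI2[of _ "- C"] simp: abs_le_iff minus_le_iff simp del: split_paired_All)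
qed

lemma continuous_on_dpp_mean:
  assumes "r > 0" "\<epsilon> > 0" "continuous_on UNIV v" "\<And>q. \<bar>v q\<bar> \<le> C"
  shows "continuous_on UNIV (dpp_mean r \<epsilon> v)"
proof -
  have c: "continuous_on UNIV (havg v \<epsilon>)"
    by (rule continuous_on_havg) (rule assms)+
  have "continuous_on UNIV (\<lambda>x. havg v \<epsilon> (fst x \<odot> hdilate r (snd x)))"
    by (intro continuous_on_compose2[OF c] continuous_intros) auto
  note this bounded_unit_hball
  moreover have "hball 0 1 \<noteq> {}"
    by (rule hball_ne) simp
  ultimately show ?thesis
    unfolding dpp_mean_def hball_eq_image[OF assms(1)] image_image
    by (intro continuous_on_add continuous_on_mult continuous_on_const c continuous_on_SUP continuous_on_INF)
qed

lemma dpp_mean_abs_le: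
  assumes "r > 0" "\<epsilon> > 0" "v \<in> borel_measurable borel" "\<And>q. \<bar>v q\<bar> \<le> C"
  shows "\<bar>dpp_mean r \<epsilon> v q\<bar> \<le> C"
proof -
  have h: "\<bar>havg v \<epsilon> q\<bar> \<le> C" for q
    by (rule havg_abs_le) (rule assms)+
  have "\<bar>(INF q'\<in>hball q r. havg v \<epsilon> q')\<bar> \<le> C" "\<bar>(SUP q'\<in>hball q r. havg v \<epsilon> q')\<bar> \<le> C"
    using h hball_ne[OF assms(1), of q] by (auto intro!: cInf_abs_ge cSup_abs_le simp del: split_paired_All)
  then show ?thesis
    using h[of q] unfolding dpp_mean_def by linarith
qed

text \<open>The unbiased average at \<open>q\<close> feels the pointwise bound \<open>b\<close>,
  whereas the other two terms look at averages around unknown points and are controlled only by the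
  global bound \<open>B\<close>. This asymmetry is what the weight below has to overcome.\<close>

lemma dpp_mean_diff_le:
  assumes r: "r > 0" and \<epsilon>: "\<epsilon> > 0"
    and u: "u \<in> borel_measurable borel" "\<And>q. \<bar>u q\<bar> \<le> C"
    and v: "v \<in> borel_measurable borel" "\<And>q. \<bar>v q\<bar> \<le> C"
    and b: "b \<in> borel_measurable borel" "\<And>q. 0 \<le> b q" "\<And>q. b q \<le> B"
    and le: "\<And>q. \<bar>u q - v q\<bar> \<le> b q"
  shows "\<bar>dpp_mean r \<epsilon> u q - dpp_mean r \<epsilon> v q\<bar> \<le> 1/3 * havg b \<epsilon> q + 2/3 * B"
proof -
  have bB: "\<bar>b q\<bar> \<le> B" for q
    using b(2,3)[of q] by linarith
  have uv: "(\<lambda>q. u q - v q) \<in> borel_measurable borel" "\<And>q. \<bar>u q - v q\<bar> \<le> B"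
    using u(1) v(1) by simp (use le b(3) order_trans in blast)
  have diff: "\<bar>havg u \<epsilon> q' - havg v \<epsilon> q'\<bar> \<le> B" for q'
    using havg_abs_le[OF \<epsilon> uv, of q'] by (simp add: havg_diff[OF \<epsilon> u v])
  have "havg (\<lambda>q. u q - v q) \<epsilon> q \<le> havg b \<epsilon> q"
    by (rule havg_mono[OF \<epsilon> uv b(1) bB]) (use le abs_le_D1 in blast)
  moreover have "havg (\<lambda>q. v q - u q) \<epsilon> q \<le> havg b \<epsilon> q"
  proof (rule havg_mono[OF \<epsilon> _ _ b(1) bB])
    show "(\<lambda>q. v q - u q) \<in> borel_measurable borel"
      using u(1) v(1) by simp
    show "\<bar>v q - u q\<bar> \<le> B" for q
      using uv(2)[of q] by linarith
    show "v q' - u q' \<le> b q'" for q'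
      using le[of q'] by linarith
  qed
  ultimately have "\<bar>havg u \<epsilon> q - havg v \<epsilon> q\<bar> \<le> havg b \<epsilon> q"
    by (simp add: havg_diff[OF \<epsilon> u v] havg_diff[OF \<epsilon> v u])
  moreover have "\<bar>(SUP q'\<in>hball q r. havg u \<epsilon> q') - (SUP q'\<in>hball q r. havg v \<epsilon> q')\<bar> \<le> B"
    by (intro abs_SUP_diff_le hball_ne r bdd_havg[OF \<epsilon> u] bdd_havg[OF \<epsilon> v] diff)
  moreover have "\<bar>(INF q'\<in>hball q r. havg u \<epsilon> q') - (INF q'\<in>hball q r. havg v \<epsilon> q')\<bar> \<le> B"
    by (intro abs_INF_diff_le hball_ne r bdd_havg[OF \<epsilon> u] bdd_havg[OF \<epsilon> v] diff)
  ultimately show ?thesis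
    unfolding dpp_mean_def by linarith
qed

text \<open>
  A weight for which the averaging operator contracts. It is \<open>C - exp (\<lambda> x)\<close> on \<open>D\<close>, with \<open>\<lambda>\<close> so
  large that the unbiased average alone multiplies the exponential by at least 6; the two biased
  averages can then be bounded trivially by \<open>C\<close>.
\<close>

lemma contraction_weight:
  assumes D: "bounded D" "open D" and \<epsilon>: "\<epsilon> > 0"
  obtains b \<theta> c B where
    "b \<in> borel_measurable borel" "0 \<le> \<theta>" "\<theta> < 1" "c > 0"
    "\<And>q. 0 \<le> b q" "\<And>q. b q \<le> B" "\<And>q. q \<in> D \<Longrightarrow> c \<le> b q" "\<And>q. q \<notin> D \<Longrightarrow> b q = 0"
    "\<And>q. q \<in> D \<Longrightarrow> 1/3 * havg b \<epsilon> q + 2/3 * B \<le> \<theta> * b q"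
proof -
  obtain R where R: "\<And>q. q \<in> D \<Longrightarrow> norm q \<le> R" "R > 0"
    using D(1) unfolding bounded_pos by blast
  have fstR: "\<bar>fst q\<bar> \<le> R" if "q \<in> D" for q
    using R(1)[OF that] norm_fst_le[of "fst q" "snd q"] by simp
  have fst1: "\<bar>fst w\<bar> \<le> 1" if "w \<in> hball 0 1" for w
    using koranyi_gauge_components(1)[of w] hdist_hmult[of 0 w] that by (simp add: mem_hball)
  \<comment> \<open>The mean of the positive part of the horizontal noise. It is positive because
    the part of the unit ball with positive first coordinate is open and nonempty.\<close>
  define m where "m = (\<integral>w. max 0 (fst w) \<partial>noise)"
  have [measurable]: "(\<lambda>w::heis. max 0 (fst w)) \<in> borel_measurable borel"
    by (intro borel_measurable_continuous_onI continuous_intros)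
  have int: "integrable noise (\<lambda>w. max 0 (fst w))"
    by (rule noise.integrable_const_bound[where B = 1]) (use fst1 in \<open>auto intro!: AE_I2 simp: abs_le_iff\<close>)
  have "m > 0"
  proof -
    let ?U = "hball 0 1 \<inter> {w. 0 < fst w}"
    have "open ?U"
      by (intro open_Int open_hball open_Collect_less continuous_intros)
    moreover have "(1/2, 0, 0) \<in> ?U"
      using hdist_hmult[of 0 "(1/2, 0, 0)"]
      by (simp add: mem_hball real_root_lt_1_iff power_divide zero_prod_def)
    then have "?U \<noteq> {}"
      by blast
    ultimately have "emeasure lborel ?U \<noteq> 0"
      using open_not_negligible[of ?U]
      by (auto simp: negligible_iff_null_sets null_sets_def null_sets_completion_iff)
    moreover have "m \<noteq> 0"
    proof
      assume "m = 0"
      then have "AE w in noise. max 0 (fst w) = 0"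
        unfolding m_def using integral_nonneg_eq_0_iff_AE[OF int] by simp
      then have "AE w in uniform_measure lborel (hball 0 1). w \<in> hball 0 1 \<longrightarrow> max 0 (fst w) = 0"
        unfolding noise_def by (subst (asm) AE_restrict_space_iff) simp_all
      then have "AE w in lborel. w \<in> hball 0 1 \<longrightarrow> max 0 (fst w) = 0"
        using emeasure_lborel_unit_hball
        by (subst (asm) AE_uniform_measure) (auto simp: top_unique less_top)
      then have "AE w in lborel. w \<notin> ?U"
        by eventually_elim auto
      then have "emeasure lborel ?U = 0"
        using \<open>open ?U\<close> by (subst (asm) AE_iff_null_sets[symmetric]) auto
      with \<open>emeasure lborel ?U \<noteq> 0\<close> show False by blast
    qed
    moreover have "m \<ge> 0"
      unfolding m_def by (rule Bochner_Integration.integral_nonneg) simp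
    ultimately show ?thesis by simp
  qed
  \<comment> \<open>The factor 1/3 turns 6 into 2: one copy of \<open>exp (l * fst q)\<close> is
    spent on rebuilding \<open>b q\<close>, the other is the slack that makes \<theta> smaller than
    1.\<close>
  define l where "l = 6 / (\<epsilon> * m)"
  have l: "l > 0" "l * \<epsilon> * m = 6"
    using \<open>m > 0\<close> \<epsilon> by (auto simp: l_def)
  \<comment> \<open>The summand \<epsilon> covers the first coordinates reached from
    \<open>D\<close> by one noise step, so that \<open>B\<close> still dominates the exponential
    there; it also puts \<open>B\<close> strictly above \<open>exp (l * R)\<close>, whence
    \<open>c > 0\<close>.\<close>
  define B where "B = exp (l * (R + \<epsilon> + 1))"
  define b where "b q = (if q \<in> D then B - exp (l * fst q) else 0)" for q :: heis
  define c where "c = B - exp (l * R)"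
  \<comment> \<open>On \<open>D\<close> the slack is at least \<open>exp (- (l * R))\<close>; since
    \<open>b q\<close> is at most \<open>B\<close>, it is worth at least the proportion
    \<open>exp (- (l * R)) / B\<close> of \<open>b q\<close>.\<close>
  define \<theta> where "\<theta> = 1 - exp (- (l * R)) / B"
  have "B > 0" by (simp add: B_def)
  have eB: "exp (l * fst q) \<le> B" if "fst q \<le> R + \<epsilon>" for q :: heis
    unfolding B_def using that l(1) by simp
  have [measurable]: "D \<in> sets borel"
    using D(2) by simp
  have bm: "b \<in> borel_measurable borel"
  proof -
    have "(\<lambda>q::heis. exp (l * fst q)) \<in> borel_measurable borel"
      by (intro borel_measurable_continuous_onI continuous_intros)
    then show ?thesis
      unfolding b_def[abs_def] by measurable
  qed
  have b0: "0 \<le> b q" for q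
  proof (cases "q \<in> D")
    case True
    then have "fst q \<le> R + \<epsilon>"
      using fstR[OF True] \<epsilon> by linarith
    then show ?thesis using eB[of q] by (simp add: b_def)
  qed (simp add: b_def)
  have bB: "b q \<le> B" for q
    using \<open>B > 0\<close> by (simp add: b_def)
  show thesis
  proof (rule that[of b \<theta> c B])
    have "exp (- (l * R)) \<le> B"
      unfolding B_def exp_le_cancel_iff using l(1) R(2) \<epsilon>
      by - (rule order_trans[of _ 0], simp_all)
    then show "0 \<le> \<theta>" "\<theta> < 1"
      using \<open>B > 0\<close> by (auto simp: \<theta>_def)
    show "c > 0"
      using l(1) \<epsilon> by (simp add: c_def B_def)
    show "c \<le> b q" if "q \<in> D" for q
      using fstR[OF that] l(1) that by (simp add: b_def c_def abs_le_iff)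
    show "1/3 * havg b \<epsilon> q + 2/3 * B \<le> \<theta> * b q" if q: "q \<in> D" for q
    proof -
      let ?e = "exp (l * fst q)"
      have "b (q \<odot> hdilate \<epsilon> w) \<le> B - ?e * (l * \<epsilon>) * max 0 (fst w)" if "w \<in> hball 0 1" for w
      proof -
        have f: "fst (q \<odot> hdilate \<epsilon> w) = fst q + \<epsilon> * fst w"
          by (simp add: hmult_eq hdilate_eq)
        have "\<epsilon> * fst w \<le> \<epsilon>"
          using fst1[OF that] \<epsilon> by (simp add: abs_le_iff)
        then have "fst (q \<odot> hdilate \<epsilon> w) \<le> R + \<epsilon>"
          using fstR[OF q] unfolding f by linarith
        \<comment> \<open>This also holds if the noise leaves \<open>D\<close>: then
          \<open>b\<close> is 0 and the right-hand side is nonnegative by the choice of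
          \<open>B\<close>.\<close>
        then have "b (q \<odot> hdilate \<epsilon> w) \<le> B - exp (l * fst (q \<odot> hdilate \<epsilon> w))"
          using eB[of "q \<odot> hdilate \<epsilon> w"] by (simp add: b_def)
        also have "exp (l * fst (q \<odot> hdilate \<epsilon> w)) = ?e * exp (l * \<epsilon> * fst w)"
          unfolding f by (simp add: exp_add algebra_simps)
        also have "B - ?e * exp (l * \<epsilon> * fst w) \<le> B - ?e * (l * \<epsilon> * max 0 (fst w))"
        proof -
          have "l * \<epsilon> * fst w \<le> exp (l * \<epsilon> * fst w)"
            using exp_ge_add_one_self[of "l * \<epsilon> * fst w"] by linarith
          then have "l * \<epsilon> * max 0 (fst w) \<le> exp (l * \<epsilon> * fst w)"
            by (simp add: max_def)
          then show ?thesis by simp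
        qed
        finally show ?thesis by (simp add: mult.assoc)
      qed
      then have "havg b \<epsilon> q \<le> (\<integral>w. B - ?e * (l * \<epsilon>) * max 0 (fst w) \<partial>noise)"
        unfolding havg_eq[OF \<epsilon> bm]
        by (intro integral_mono integrable_noise[of b B] Bochner_Integration.integrable_diff integrable_mult_right int)
          (use bm b0 bB in auto)
      also have "\<dots> = B - ?e * (l * \<epsilon> * m)"
        using int noise.prob_space by (simp add: m_def Bochner_Integration.integral_diff)
      finally have "1/3 * havg b \<epsilon> q + 2/3 * B \<le> B - 2 * ?e"
        using l(2) by (simp add: mult.assoc)
      also have "\<dots> = b q - ?e"
        using q by (simp add: b_def)
      also have "\<dots> \<le> b q - exp (- (l * R))"
        using fstR[OF q] l(1) mult_left_mono[of "- R" "fst q" l] by (simp add: abs_le_iff)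
      also have "\<dots> \<le> b q - exp (- (l * R)) * (b q / B)"
        using bB[of q] \<open>B > 0\<close> mult_left_mono[of "b q / B" 1 "exp (- (l * R))"] by simp
      also have "\<dots> = \<theta> * b q"
        by (simp add: \<theta>_def algebra_simps)
      finally show ?thesis .
    qed
    show "b q = 0" if "q \<notin> D" for q
      using that by (simp add: b_def)
  qed (rule bm b0 bB)+
qed

section \<open>Existence by Picard iteration\<close>

text \<open>The increments of the iterates starting at \<open>F\<close> are at most a geometric
  sequence times the weight \<open>b\<close>. As \<open>b\<close> is bounded, the iterates converge
  uniformly, and the limit inherits continuity and the bound \<open>C\<close>.\<close>

lemma dpp_solution_exists:
  assumes D: "bounded D" "open D" and \<epsilon>: "\<epsilon> > 0" and p: "p > 2"
    and F: "continuous_on UNIV F" "bounded (range F)"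
  shows "\<exists>u. dpp_solution D p F \<epsilon> u"
proof -
  define r where "r = gamma_p p * \<epsilon>"
  have r: "r > 0"
    using p \<epsilon> by (simp add: r_def gamma_p_def)
  have D': "- D \<noteq> {}"
    using D(1) not_bounded_UNIV by (metis Compl_empty_eq double_complement)
  note d01 = cutoff_bounds[OF \<epsilon> D']
  obtain C where C: "\<And>q. \<bar>F q\<bar> \<le> C"
    using F(2) unfolding bounded_iff by auto
  obtain b \<theta> c B where b: "b \<in> borel_measurable borel" "0 \<le> \<theta>" "\<theta> < 1" "c > 0"
    "\<And>q. 0 \<le> b q" "\<And>q. b q \<le> B" "\<And>q. q \<in> D \<Longrightarrow> c \<le> b q" "\<And>q. q \<notin> D \<Longrightarrow> b q = 0"
    "\<And>q. q \<in> D \<Longrightarrow> 1/3 * havg b \<epsilon> q + 2/3 * B \<le> \<theta> * b q"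
    using contraction_weight[OF D \<epsilon>] by metis
  define T where "T v q = cutoff D \<epsilon> q * dpp_mean r \<epsilon> v q + (1 - cutoff D \<epsilon> q) * F q" for v q
  have T_cont: "continuous_on UNIV (T v)" if "continuous_on UNIV v" "\<And>q. \<bar>v q\<bar> \<le> C" for v
    unfolding T_def
    by (intro continuous_intros F(1) continuous_on_cutoff \<epsilon> D' continuous_on_dpp_mean[where C = C] r that)
  have T_bound: "\<bar>T v q\<bar> \<le> C" if v: "continuous_on UNIV v" "\<And>q. \<bar>v q\<bar> \<le> C" for v q
  proof -
    have "\<bar>dpp_mean r \<epsilon> v q\<bar> \<le> C"
      by (rule dpp_mean_abs_le[OF r \<epsilon> borel_measurable_continuous_onI]) (rule v)+
    have "\<bar>T v q\<bar> \<le> cutoff D \<epsilon> q * \<bar>dpp_mean r \<epsilon> v q\<bar> + (1 - cutoff D \<epsilon> q) * \<bar>F q\<bar>"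
      unfolding T_def
      using abs_triangle_ineq[of "cutoff D \<epsilon> q * dpp_mean r \<epsilon> v q" "(1 - cutoff D \<epsilon> q) * F q"] d01[of q]
      by (simp add: abs_mult)
    also have "\<dots> \<le> C"
      by (rule convex_bound_le) (use C d01 \<open>\<bar>dpp_mean r \<epsilon> v q\<bar> \<le> C\<close> in auto)
    finally show ?thesis .
  qed
  have T_diff: "T u q - T v q = cutoff D \<epsilon> q * (dpp_mean r \<epsilon> u q - dpp_mean r \<epsilon> v q)" for u v q
    by (simp add: T_def algebra_simps)
  define U where "U n = (T ^^ n) F" for n
  have U: "continuous_on UNIV (U n) \<and> (\<forall>q. \<bar>U n q\<bar> \<le> C)" for n
  proof (induction n)
    case 0
    then show ?case using F C by (simp add: U_def del: split_paired_All)
  next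
    case (Suc n)
    have "U (Suc n) = T (U n)" by (simp add: U_def)
    then show ?case using T_cont[of "U n"] T_bound[of "U n"] Suc by metis
  qed
  have Uc: "continuous_on UNIV (U n)" and UC: "\<bar>U n q\<bar> \<le> C" for n q
    using U by blast+
  have Um: "U n \<in> borel_measurable borel" for n
    by (rule borel_measurable_continuous_onI) (rule Uc)
  \<comment> \<open>Makes \<open>K * c\<close> equal to the crude bound \<open>2 * C\<close> for the
    first increment, while \<open>b\<close> is at least \<open>c\<close> on \<open>D\<close>. Off
    \<open>D\<close> every iterate equals \<open>F\<close>, so increments vanish there together with
    \<open>b\<close>.\<close>
  define K where "K = 2 * C / c"
  have "C \<ge> 0" using C[of 0] by linarith
  then have K: "K \<ge> 0" using b(4) by (simp add: K_def)
  have step: "\<bar>U (Suc n) q - U n q\<bar> \<le> K * \<theta> ^ n * b q" for n q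
  proof (induction n arbitrary: q)
    case 0
    show ?case
    proof (cases "q \<in> D")
      case True
      have "\<bar>U (Suc 0) q - U 0 q\<bar> \<le> 2 * C"
        using UC[of "Suc 0" q] UC[of 0 q] by linarith
      also have "2 * C = K * c" using b(4) by (simp add: K_def)
      also have "\<dots> \<le> K * b q" by (intro mult_left_mono K b(7) True)
      finally show ?thesis by simp
    next
      case False
      then show ?thesis
        using b(8)[OF False] by (simp add: U_def T_def cutoff_eq_0[OF \<epsilon>])
    qed
  next
    case (Suc n)
    have TT: "U (Suc (Suc n)) q - U (Suc n) q
        = cutoff D \<epsilon> q * (dpp_mean r \<epsilon> (U (Suc n)) q - dpp_mean r \<epsilon> (U n) q)"
      using T_diff by (simp add: U_def)
    show ?case
    proof (cases "q \<in> D")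
      case True
      let ?k = "K * \<theta> ^ n"
      have k: "?k \<ge> 0" using K b(2) by simp
      have "\<bar>dpp_mean r \<epsilon> (U (Suc n)) q - dpp_mean r \<epsilon> (U n) q\<bar>
          \<le> 1/3 * havg (\<lambda>q. ?k * b q) \<epsilon> q + 2/3 * (?k * B)"
        using b K
        by (intro dpp_mean_diff_le[OF r \<epsilon> Um UC Um UC] Suc.IH mult_left_mono mult_nonneg_nonneg) simp_all
      also have "havg (\<lambda>q. ?k * b q) \<epsilon> q = ?k * havg b \<epsilon> q"
        using b(1) by (simp add: havg_eq[OF \<epsilon>])
      also have "1/3 * (?k * havg b \<epsilon> q) + 2/3 * (?k * B) = ?k * (1/3 * havg b \<epsilon> q + 2/3 * B)"
        by (simp add: algebra_simps)
      also have "\<dots> \<le> ?k * (\<theta> * b q)"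
        by (intro mult_left_mono k b(9) True)
      finally have "\<bar>dpp_mean r \<epsilon> (U (Suc n)) q - dpp_mean r \<epsilon> (U n) q\<bar> \<le> K * \<theta> ^ Suc n * b q"
        by (simp add: algebra_simps)
      moreover have "\<bar>U (Suc (Suc n)) q - U (Suc n) q\<bar> \<le> \<bar>dpp_mean r \<epsilon> (U (Suc n)) q - dpp_mean r \<epsilon> (U n) q\<bar>"
        unfolding TT abs_mult using d01[of q] by (simp add: mult_left_le_one_le)
      ultimately show ?thesis by linarith
    next
      case False
      then show ?thesis
        using b(8)[OF False] TT by (simp add: cutoff_eq_0[OF \<epsilon>])
    qed
  qed
  define u where "u q = F q + (\<Sum>n. U (Suc n) q - U n q)" for q
  have "uniform_limit UNIV (\<lambda>n q. \<Sum>i<n. U (Suc i) q - U i q) (\<lambda>q. \<Sum>n. U (Suc n) q - U n q) sequentially"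
  proof (rule Weierstrass_m_test)
    show "norm (U (Suc n) q - U n q) \<le> K * B * \<theta> ^ n" for n q
    proof -
      have "K * \<theta> ^ n * b q \<le> K * \<theta> ^ n * B"
        using K b(2) by (intro mult_left_mono b(6)) simp
      then show ?thesis using step[of n q] by (simp add: algebra_simps)
    qed
    show "summable (\<lambda>n. K * B * \<theta> ^ n)"
      using b(2,3) by (intro summable_mult summable_geometric) simp
  qed
  moreover have "(\<Sum>i<n. U (Suc i) q - U i q) = U n q - F q" for n q
  proof -
    have "U 0 q = F q" by (simp add: U_def)
    then show ?thesis
      using sum_lessThan_telescope[of "\<lambda>n. U n q" n] by simp
  qed
  ultimately have "uniform_limit UNIV (\<lambda>n q. F q + (U n q - F q)) u sequentially"
    unfolding u_def by (intro uniform_limit_add uniform_limit_const) simp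
  then have lim: "uniform_limit UNIV U u sequentially"
    by simp
  have uc: "continuous_on UNIV u"
    by (rule uniform_limit_theorem[OF _ lim]) (simp_all add: Uc)
  have pt: "(\<lambda>n. U n q) \<longlonglongrightarrow> u q" for q
    using tendsto_uniform_limitI[OF lim] by simp
  have ub: "\<bar>u q\<bar> \<le> C" for q
    by (rule LIMSEQ_le_const2[OF tendsto_rabs[OF pt]]) (intro exI allI impI UC)
  have "T u q = u q" for q
  proof -
    have "(\<lambda>n. T (U n) q) \<longlonglongrightarrow> T u q"
    proof (rule LIMSEQ_I)
      fix e :: real assume "e > 0"
      then obtain N where "\<forall>n\<ge>N. \<forall>q\<in>UNIV. dist (U n q) (u q) < e / 2"
        using uniform_limitD[OF lim, of "e / 2"] unfolding eventually_sequentially by auto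
      then have N: "\<bar>U n q - u q\<bar> \<le> e / 2" if "n \<ge> N" for n q
        using that unfolding dist_real_def by (intro less_imp_le) blast
      have "norm (T (U n) q - T u q) < e" if "n \<ge> N" for n
      proof -
        \<comment> \<open>A constant weight is enough for the limit passage: convergence is uniform
          and averaging is nonexpansive in the sup norm.\<close>
        have "\<bar>dpp_mean r \<epsilon> (U n) q - dpp_mean r \<epsilon> u q\<bar> \<le> 1/3 * havg (\<lambda>_. e/2) \<epsilon> q + 2/3 * (e/2)"
          using \<open>e > 0\<close>
          by (intro dpp_mean_diff_le[OF r \<epsilon> Um UC borel_measurable_continuous_onI[OF uc] ub] N that) simp_all
        also have "\<dots> = e / 2"
          using noise.prob_space by (simp add: havg_eq[OF \<epsilon>])
        finally have "\<bar>dpp_mean r \<epsilon> (U n) q - dpp_mean r \<epsilon> u q\<bar> < e"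
          using \<open>e > 0\<close> by linarith
        moreover have "\<bar>T (U n) q - T u q\<bar> \<le> \<bar>dpp_mean r \<epsilon> (U n) q - dpp_mean r \<epsilon> u q\<bar>"
          unfolding T_diff abs_mult using d01[of q] by (simp add: mult_left_le_one_le)
        ultimately show ?thesis by simp
      qed
      then show "\<exists>N. \<forall>n\<ge>N. norm (T (U n) q - T u q) < e" by blast
    qed
    moreover have "(\<lambda>n. T (U n) q) \<longlonglongrightarrow> u q"
      using LIMSEQ_Suc[OF pt[of q]] by (simp add: U_def)
    ultimately show ?thesis
      by (rule LIMSEQ_unique)
  qed
  then have "\<forall>q. u q = T u q"
    by (simp del: split_paired_All)
  moreover have "bounded (range u)"
    using ub by (intro boundedI[of _ C]) (metis imageE real_norm_def)
  ultimately have "dpp_solution D p F \<epsilon> u"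
    unfolding dpp_solution_iff r_def[symmetric] T_def using uc by (intro conjI)
  then show ?thesis by (rule exI[of _ u])
qed

section \<open>The game space\<close>

definition coin :: "nat measure" where
  "coin = uniform_count_measure {1, 2, 3}"

definition clock :: "real measure" where
  "clock = restrict_space lborel {0<..<1}"

lemma step_space_eq: "step_space = noise \<Otimes>\<^sub>M (coin \<Otimes>\<^sub>M clock)"
  unfolding step_space_def noise_def coin_def clock_def ..

interpretation coin: prob_space coin
  unfolding coin_def by (rule prob_space_uniform_count_measure) auto

interpretation clock: prob_space clock
  unfolding clock_def by (rule prob_spaceI) (simp add: emeasure_restrict_space space_restrict_space)

interpretation coin_clock: pair_prob_space coin clock ..

interpretation step_pair: pair_prob_space noise "coin \<Otimes>\<^sub>M clock" ..

interpretation step: prob_space step_space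
  unfolding step_space_eq by (rule step_pair.prob_space_axioms)

interpretation game: prob_space game_space
  unfolding game_space_def by (rule prob_space_PiM) (rule step.prob_space_axioms)

lemma measurable_coin: "f \<in> measurable coin (count_space UNIV)"
  unfolding coin_def
  by (subst measurable_cong_sets[OF sets_uniform_count_measure_count_space refl]) simp

lemma measurable_clock: "(\<lambda>t. t) \<in> borel_measurable clock"
  unfolding clock_def by (rule measurable_restrict_space1) simp

lemma measurable_step [measurable]:
  shows "fst \<in> borel_measurable step_space"
    "(\<lambda>x. fst (snd x)) \<in> measurable step_space (count_space UNIV)"
    "(\<lambda>x. snd (snd x)) \<in> borel_measurable step_space"
proof -
  have "(\<lambda>x. (\<lambda>w. w) (fst x)) \<in> borel_measurable step_space"
    unfolding step_space_eq by (rule measurable_compose[OF measurable_fst measurable_noiseI]) simp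
  then show "fst \<in> borel_measurable step_space" by simp
  show "(\<lambda>x. fst (snd x)) \<in> measurable step_space (count_space UNIV)"
    unfolding step_space_eq
    by (rule measurable_compose[OF measurable_snd measurable_compose[OF measurable_fst measurable_coin]])
  show "(\<lambda>x. snd (snd x)) \<in> borel_measurable step_space"
    unfolding step_space_eq
    by (rule measurable_compose[OF measurable_snd measurable_compose[OF measurable_snd measurable_clock]])
qed

lemma space_step_space: "space step_space = hball 0 1 \<times> {1, 2, 3} \<times> {0<..<1}"
  by (simp add: step_space_eq space_pair_measure coin_def clock_def space_restrict_space space_uniform_count_measure)

lemma integral_clock:
  assumes "0 \<le> d" "d \<le> 1"
  shows "(\<integral>t. (if t \<le> d then a else c) \<partial>clock) = d * a + (1 - d) * (c::real)"
proof -
  have [measurable]: "(\<lambda>t. t) \<in> borel_measurable clock" by (rule measurable_clock)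
  have sp: "space clock = {0<..<1}"
    by (simp add: clock_def space_restrict_space)
  have "(\<integral>t. (if t \<le> d then a else c) \<partial>clock) = (\<integral>t. c + (a - c) * indicator {t \<in> space clock. t \<le> d} t \<partial>clock)"
    by (intro Bochner_Integration.integral_cong) (auto simp: indicator_def)
  also have "\<dots> = c + (a - c) * clock.prob {t \<in> space clock. t \<le> d}"
    using clock.prob_space by (simp add: Bochner_Integration.integral_add clock.emeasure_eq_measure)
  also have "clock.prob {t \<in> space clock. t \<le> d} = measure lborel {t \<in> {0<..<1}. t \<le> d}"
    unfolding sp unfolding clock_def by (rule measure_restrict_space) auto
  also have "\<dots> = d"
  proof (cases "d = 1")
    case True
    then have "{t \<in> {0<..<1}. t \<le> d} = {0<..<1}" by auto
    then show ?thesis using True by simp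
  next
    case False
    then have "{t \<in> {0<..<1}. t \<le> d} = {0<..d}" using assms by auto
    then show ?thesis using assms by simp
  qed
  finally show ?thesis by (simp add: algebra_simps)
qed

text \<open>Fubini, with the clock innermost: it continues the round with probability
  \<open>d\<close>. The value \<open>c\<close> on stopping depends on neither coin nor noise, since
  a stopped game is paid at the position before the move.\<close>

lemma integral_step_space:
  fixes G :: "nat \<Rightarrow> heis \<Rightarrow> real"
  assumes d: "0 \<le> d" "d \<le> 1" and G: "\<And>s. G s \<in> borel_measurable borel" "\<And>s w. \<bar>G s w\<bar> \<le> C"
  shows "(\<integral>x. (if snd (snd x) \<le> d then G (fst (snd x)) (fst x) else c) \<partial>step_space)
    = d * (1/3 * (\<integral>w. G 1 w \<partial>noise) + 1/3 * (\<integral>w. G 2 w \<partial>noise) + 1/3 * (\<integral>w. G 3 w \<partial>noise)) + (1 - d) * c"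
proof -
  let ?f = "\<lambda>x. if snd (snd x) \<le> d then G (fst (snd x)) (fst x) else c"
  have Gm: "(\<lambda>x. G (fst (snd x)) (fst x)) \<in> borel_measurable step_space"
    by (rule measurable_compose_countable'[where I = UNIV and g = "\<lambda>x. fst (snd x)" and f = "\<lambda>s x. G s (fst x)"])
      (use G(1) in measurable)
  have f [measurable]: "?f \<in> borel_measurable step_space"
    using Gm by measurable
  have fb: "\<bar>?f x\<bar> \<le> max C \<bar>c\<bar>" for x
    using G(2)[of "fst (snd x)" "fst x"] by auto
  have int: "integrable step_space ?f"
    by (rule step.integrable_const_bound[where B = "max C \<bar>c\<bar>"]) (use fb f in auto)
  have "(\<integral>x. ?f x \<partial>step_space) = (\<integral>w. \<integral>y. ?f (w, y) \<partial>(coin \<Otimes>\<^sub>M clock) \<partial>noise)"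
    using int unfolding step_space_eq by (rule step_pair.integral_fst'[symmetric])
  also have "\<dots> = (\<integral>w. 1/3 * (d * G 1 w + (1 - d) * c) + 1/3 * (d * G 2 w + (1 - d) * c)
      + 1/3 * (d * G 3 w + (1 - d) * c) \<partial>noise)"
  proof (rule Bochner_Integration.integral_cong[OF refl])
    fix w
    have sm: "(\<lambda>y. if snd y \<le> d then G (fst y) w else c) \<in> borel_measurable (coin \<Otimes>\<^sub>M clock)"
    proof -
      have [measurable]: "(\<lambda>y. G (fst y) w) \<in> borel_measurable (coin \<Otimes>\<^sub>M clock)"
        by (rule measurable_compose[OF measurable_compose[OF measurable_fst measurable_coin]]) simp
      have [measurable]: "snd \<in> borel_measurable (coin \<Otimes>\<^sub>M clock)"
        by (rule measurable_compose[OF measurable_snd measurable_clock])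
      show ?thesis by measurable
    qed
    have "integrable (coin \<Otimes>\<^sub>M clock) (\<lambda>y. if snd y \<le> d then G (fst y) w else c)"
      by (rule coin_clock.integrable_const_bound[where B = "max C \<bar>c\<bar>"])
        (use G(2)[of _ w] sm in \<open>auto intro!: AE_I2 simp: le_max_iff_disj\<close>)
    then have "(\<integral>y. (if snd y \<le> d then G (fst y) w else c) \<partial>(coin \<Otimes>\<^sub>M clock))
        = (\<integral>s. \<integral>t. (if t \<le> d then G s w else c) \<partial>clock \<partial>coin)"
      by (subst coin_clock.integral_fst'[symmetric]) (simp_all only: fst_conv snd_conv)
    also have "\<dots> = (\<integral>s. d * G s w + (1 - d) * c \<partial>coin)"
      by (simp only: integral_clock[OF d])
    also have "\<dots> = (\<Sum>s\<in>{1, 2, 3}. d * G s w + (1 - d) * c) / card {1::nat, 2, 3}"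
      unfolding coin_def by (rule integral_uniform_count_measure) simp
    finally show "(\<integral>y. ?f (w, y) \<partial>(coin \<Otimes>\<^sub>M clock)) = 1/3 * (d * G 1 w + (1 - d) * c)
      + 1/3 * (d * G 2 w + (1 - d) * c) + 1/3 * (d * G 3 w + (1 - d) * c)"
      by (simp only: fst_conv snd_conv) (simp add: field_simps)
  qed
  also have "\<dots> = 1/3 * (d * (\<integral>w. G 1 w \<partial>noise) + (1 - d) * c) + 1/3 * (d * (\<integral>w. G 2 w \<partial>noise) + (1 - d) * c)
      + 1/3 * (d * (\<integral>w. G 3 w \<partial>noise) + (1 - d) * c)"
  proof -
    have [simp]: "integrable noise (G s)" for s
      by (rule noise.integrable_const_bound[where B = C]) (use G in auto)
    show ?thesis
      using noise.prob_space by simp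
  qed
  finally show ?thesis by (simp add: algebra_simps)
qed

section \<open>Resampling one coordinate of the product space\<close>

text \<open>Plays the part of conditioning on all outcomes but the \<open>i\<close>-th. Splitting
  off that coordinate turns either side into the same integral over the remaining ones, because the
  inner integral on the right no longer depends on the old value at \<open>i\<close>.\<close>

lemma integral_game_space_resample:
  fixes f :: "(nat \<Rightarrow> outcome) \<Rightarrow> real"
  assumes i: "i \<ge> 1" and f: "f \<in> borel_measurable game_space"
    and C: "\<And>\<omega>. \<omega> \<in> space game_space \<Longrightarrow> \<bar>f \<omega>\<bar> \<le> C"
  shows "(\<integral>\<omega>. f \<omega> \<partial>game_space) = (\<integral>\<omega>. \<integral>x. f (fun_upd \<omega> i x) \<partial>step_space \<partial>game_space)"
proof -
  define J where "J = {1::nat..} - {i}"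
  define P where "P = PiM J (\<lambda>_. step_space)"
  interpret P: prob_space P
    unfolding P_def by (rule prob_space_PiM) (rule step.prob_space_axioms)
  have I: "insert i J = {1..}" using i by (auto simp: J_def)
  have iJ: "i \<notin> J" by (simp add: J_def)
  have gs: "game_space = PiM (insert i J) (\<lambda>_. step_space)"
    unfolding game_space_def I ..
  interpret pr: pair_prob_space step_space P ..
  have um [measurable]: "(\<lambda>y. fun_upd (snd y) i (fst y)) \<in> measurable (step_space \<Otimes>\<^sub>M P) game_space"
    unfolding gs P_def by (rule measurable_fun_upd[where J = J]) auto
  have dist: "distr (step_space \<Otimes>\<^sub>M P) game_space (\<lambda>y. fun_upd (snd y) i (fst y)) = game_space"
    using distr_pair_PiM_eq_PiM[of J "\<lambda>_. step_space" i] iJ step.prob_space_axioms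
    unfolding gs P_def by (simp add: case_prod_beta')
  have inP: "fun_upd X i x \<in> space game_space" if "X \<in> space P" "x \<in> space step_space" for X x
    using measurable_space[OF um, of "(x, X)"] that by (simp add: space_pair_measure)
  have main: "(\<integral>\<omega>. g \<omega> \<partial>game_space) = (\<integral>X. \<integral>x. g (fun_upd X i x) \<partial>step_space \<partial>P)"
    if g [measurable]: "g \<in> borel_measurable game_space"
      and gC: "\<And>\<omega>. \<omega> \<in> space game_space \<Longrightarrow> \<bar>g \<omega>\<bar> \<le> C" for g
  proof -
    have "(\<integral>\<omega>. g \<omega> \<partial>game_space) = (\<integral>y. g (fun_upd (snd y) i (fst y)) \<partial>(step_space \<Otimes>\<^sub>M P))"
      by (subst dist[symmetric], rule integral_distr) measurable
    also have "\<dots> = (\<integral>X. \<integral>x. g (fun_upd X i x) \<partial>step_space \<partial>P)"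
    proof -
      have "integrable (step_space \<Otimes>\<^sub>M P) (\<lambda>(x, X). g (fun_upd X i x))"
      proof (rule pr.integrable_const_bound[where B = C])
        show "AE y in step_space \<Otimes>\<^sub>M P. norm (case y of (x, X) \<Rightarrow> g (fun_upd X i x)) \<le> C"
          using gC inP by (intro AE_I2) (simp add: space_pair_measure case_prod_beta' mem_Times_iff)
        show "(\<lambda>(x, X). g (fun_upd X i x)) \<in> borel_measurable (step_space \<Otimes>\<^sub>M P)"
          unfolding case_prod_beta' by measurable
      qed
      from pr.integral_snd[OF this] show ?thesis
        by (simp add: case_prod_beta')
    qed
    finally show ?thesis .
  qed
  let ?h = "\<lambda>\<omega>. \<integral>x. f (fun_upd \<omega> i x) \<partial>step_space"
  have u2: "(\<lambda>y. fun_upd (fst y) i (snd y)) \<in> measurable (game_space \<Otimes>\<^sub>M step_space) game_space"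
    unfolding gs by (rule measurable_fun_upd[where J = "insert i J"]) auto
  have hm: "?h \<in> borel_measurable game_space"
    using measurable_compose[OF u2 f]
    by (intro step.borel_measurable_lebesgue_integral) (simp add: case_prod_beta')
  have inG: "fun_upd \<omega> i x \<in> space game_space" if "\<omega> \<in> space game_space" "x \<in> space step_space" for \<omega> x
    using measurable_space[OF u2, of "(\<omega>, x)"] that by (simp add: space_pair_measure)
  have hC: "\<bar>?h \<omega>\<bar> \<le> C" if \<omega>: "\<omega> \<in> space game_space" for \<omega>
  proof -
    have "(\<lambda>x. f (fun_upd \<omega> i x)) \<in> borel_measurable step_space"
      using measurable_compose[OF measurable_Pair1'[OF \<omega>] measurable_compose[OF u2 f]] by simp
    then have "integrable step_space (\<lambda>x. f (fun_upd \<omega> i x))"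
      by (intro step.integrable_const_bound[where B = C]) (use inG[OF \<omega>] C in auto)
    then have "(\<integral>x. norm (f (fun_upd \<omega> i x)) \<partial>step_space) \<le> (\<integral>x. C \<partial>step_space)"
      using C inG[OF \<omega>] by (intro integral_mono integrable_norm) simp_all
    then have "norm (?h \<omega>) \<le> (\<integral>x. C \<partial>step_space)"
      by (rule order_trans[OF integral_norm_bound])
    then show ?thesis using step.prob_space by simp
  qed
  have "(\<integral>\<omega>. ?h \<omega> \<partial>game_space) = (\<integral>X. \<integral>x. ?h (fun_upd X i x) \<partial>step_space \<partial>P)"
    by (rule main[OF hm hC])
  also have "\<dots> = (\<integral>X. ?h X \<partial>P)"
    using step.prob_space by simp
  also have "\<dots> = (\<integral>\<omega>. f \<omega> \<partial>game_space)"
    by (rule main[OF f C, symmetric])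
  finally show ?thesis by simp
qed

section \<open>One round of the game\<close>

locale tug_of_war =
  fixes D :: "heis set" and p \<epsilon> :: real and q\<^sub>0 :: heis and \<sigma>\<^sub>I \<sigma>\<^sub>I\<^sub>I :: "nat \<Rightarrow> history \<Rightarrow> heis"
  assumes p: "p > 2" and \<epsilon>: "\<epsilon> > 0" and D: "bounded D" "open D"
    and strategies: "strategy \<sigma>\<^sub>I" "strategy \<sigma>\<^sub>I\<^sub>I"
begin

abbreviation Q :: "nat \<Rightarrow> (nat \<Rightarrow> outcome) \<Rightarrow> heis" where
  "Q n \<equiv> position p \<epsilon> q\<^sub>0 \<sigma>\<^sub>I \<sigma>\<^sub>I\<^sub>I n"

abbreviation (input) clk :: "nat \<Rightarrow> (nat \<Rightarrow> outcome) \<Rightarrow> real" where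
  "clk n \<omega> \<equiv> snd (snd (\<omega> n))"

definition hist :: "nat \<Rightarrow> (nat \<Rightarrow> outcome) \<Rightarrow> history" where
  "hist n \<omega> = (q\<^sub>0, \<lambda>k\<in>{1..n}. (Q k \<omega>, \<omega> k))"

text \<open>The event that the game has not stopped by round \<open>n\<close>. It is written without
  \<open>stop_time\<close> so that it visibly depends on the outcomes 1 to \<open>n\<close> only and
  satisfies a one-step recursion.\<close>

definition alive :: "nat \<Rightarrow> (nat \<Rightarrow> outcome) \<Rightarrow> bool" where
  "alive n \<omega> \<longleftrightarrow> (\<forall>k\<in>{1..n}. clk k \<omega> \<le> cutoff D \<epsilon> (Q (k - 1) \<omega>))"

definition move :: "heis \<Rightarrow> heis \<Rightarrow> heis \<Rightarrow> nat \<Rightarrow> heis \<Rightarrow> heis" where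
  "move q a b s w =
     (if s = 1 then q \<odot> hdilate (gamma_p p * \<epsilon>) a else if s = 2 then q \<odot> hdilate (gamma_p p * \<epsilon>) b else q)
     \<odot> hdilate \<epsilon> w"

lemma compl_D_ne: "- D \<noteq> {}"
  using D(1) not_bounded_UNIV by (metis Compl_empty_eq double_complement)

lemma step_pos: "gamma_p p * \<epsilon> > 0"
  using p \<epsilon> by (simp add: gamma_p_def)

lemma Q_Suc: "Q (Suc m) \<omega> = move (Q m \<omega>) (\<sigma>\<^sub>I m (hist m \<omega>)) (\<sigma>\<^sub>I\<^sub>I m (hist m \<omega>)) (fst (snd (\<omega> (Suc m)))) (fst (\<omega> (Suc m)))"
  by (simp add: hist_def move_def Let_def case_prod_beta')

lemma measurable_coordinate [measurable]:
  "k \<ge> 1 \<Longrightarrow> (\<lambda>\<omega>. \<omega> k) \<in> measurable game_space step_space"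
  unfolding game_space_def by (rule measurable_component_singleton) simp

text \<open>Positions use histories and histories contain positions. Assuming measurability of the
  earlier positions allows this to be used inside the strong induction that proves it for all of
  them.\<close>

lemma measurable_hist_aux:
  assumes "\<And>k. k \<le> n \<Longrightarrow> Q k \<in> borel_measurable game_space"
  shows "hist n \<in> measurable game_space (history_space n)"
  unfolding hist_def[abs_def] history_space_def
  by (intro measurable_Pair measurable_const measurable_restrict measurable_coordinate) (use assms in auto)

lemma measurable_strategy:
  assumes "strategy \<sigma>"
  shows "\<sigma> n \<in> measurable (history_space n) borel" "\<And>h. h \<in> space (history_space n) \<Longrightarrow> \<sigma> n h \<in> hball 0 1"
proof -
  have "\<sigma> n \<in> measurable (history_space n) (restrict_space borel (hball 0 1))"
    using assms by (simp add: strategy_def)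
  then show "\<sigma> n \<in> measurable (history_space n) borel" "\<And>h. h \<in> space (history_space n) \<Longrightarrow> \<sigma> n h \<in> hball 0 1"
    by (auto simp: measurable_restrict_space2_iff simp del: split_paired_All)
qed

lemma borel_measurable_hmult:
  fixes f g :: "'a \<Rightarrow> heis"
  assumes "f \<in> borel_measurable M" "g \<in> borel_measurable M"
  shows "(\<lambda>x. f x \<odot> g x) \<in> borel_measurable M"
  by (rule borel_measurable_continuous_Pair[OF assms]) (intro continuous_intros)

lemma borel_measurable_hdilate:
  fixes f :: "'a \<Rightarrow> heis"
  assumes "f \<in> borel_measurable M"
  shows "(\<lambda>x. hdilate l (f x)) \<in> borel_measurable M"
  by (rule measurable_compose[OF assms]) (intro borel_measurable_continuous_onI continuous_intros)

lemma measurable_Q [measurable]: "Q n \<in> borel_measurable game_space"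
proof (induction n rule: less_induct)
  case (less n)
  show ?case
  proof (cases n)
    case 0
    then show ?thesis by simp
  next
    case (Suc m)
    have h: "hist m \<in> measurable game_space (history_space m)"
      by (rule measurable_hist_aux) (use less Suc in simp)
    have [measurable]: "Q m \<in> borel_measurable game_space"
      using less Suc by simp
    have I [measurable]: "(\<lambda>\<omega>. \<sigma>\<^sub>I m (hist m \<omega>)) \<in> borel_measurable game_space"
      by (rule measurable_compose[OF h measurable_strategy(1)[OF strategies(1)]])
    have II [measurable]: "(\<lambda>\<omega>. \<sigma>\<^sub>I\<^sub>I m (hist m \<omega>)) \<in> borel_measurable game_space"
      by (rule measurable_compose[OF h measurable_strategy(1)[OF strategies(2)]])
    have c: "(\<lambda>\<omega>. \<omega> (Suc m)) \<in> measurable game_space step_space"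
      by (rule measurable_coordinate) simp
    have [measurable]: "(\<lambda>\<omega>. fst (\<omega> (Suc m))) \<in> borel_measurable game_space"
      by (rule measurable_compose[OF c measurable_step(1)])
    have [measurable]: "(\<lambda>\<omega>. fst (snd (\<omega> (Suc m)))) \<in> measurable game_space (count_space UNIV)"
      by (rule measurable_compose[OF c measurable_step(2)])
    show ?thesis
      unfolding Suc Q_Suc[abs_def] move_def
      by (intro borel_measurable_hmult borel_measurable_hdilate measurable_If) measurable
  qed
qed

lemma measurable_hist [measurable]: "hist n \<in> measurable game_space (history_space n)"
  by (rule measurable_hist_aux) (rule measurable_Q)

lemma strategy_mem:
  assumes "\<omega> \<in> space game_space"
  shows "\<sigma>\<^sub>I n (hist n \<omega>) \<in> hball 0 1" "\<sigma>\<^sub>I\<^sub>I n (hist n \<omega>) \<in> hball 0 1"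
  using measurable_space[OF measurable_hist assms] measurable_strategy(2) strategies by blast+

lemma measurable_clk [measurable]: "k \<ge> 1 \<Longrightarrow> clk k \<in> borel_measurable game_space"
  by (rule measurable_compose[OF measurable_coordinate measurable_step(3)])

lemma borel_measurable_cutoff [measurable]: "cutoff D \<epsilon> \<in> borel_measurable borel"
  by (intro borel_measurable_continuous_onI continuous_on_cutoff \<epsilon> compl_D_ne)

lemma measurable_round [measurable]:
  "k \<ge> 1 \<Longrightarrow> Measurable.pred game_space (\<lambda>\<omega>. clk k \<omega> \<le> cutoff D \<epsilon> (Q (k - 1) \<omega>))"
  unfolding pred_def
  by (intro borel_measurable_le measurable_clk measurable_compose[OF measurable_Q borel_measurable_cutoff])

lemma measurable_alive [measurable]: "Measurable.pred game_space (alive n)"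
  unfolding alive_def[abs_def]
  by (intro pred_intros_finite measurable_round) auto

lemma alive_0 [simp]: "alive 0 \<omega>"
  by (simp add: alive_def)

lemma alive_Suc: "alive (Suc n) \<omega> \<longleftrightarrow> alive n \<omega> \<and> clk (Suc n) \<omega> \<le> cutoff D \<epsilon> (Q n \<omega>)"
proof -
  have "{1..Suc n} = insert (Suc n) {1..n}" by auto
  then show ?thesis unfolding alive_def by auto
qed

text \<open>Adaptedness, expressed without a filtration; the update rules that follow are what
  resampling a later coordinate requires.\<close>

lemma Q_cong:
  assumes "\<And>k. k \<in> {1..n} \<Longrightarrow> \<omega> k = \<omega>' k"
  shows "Q n \<omega> = Q n \<omega>'"
  using assms
proof (induction n rule: less_induct)
  case (less n)
  show ?case
  proof (cases n)
    case (Suc m)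
    have "hist m \<omega> = hist m \<omega>'"
      unfolding hist_def using less Suc by (auto simp: restrict_def fun_eq_iff)
    then show ?thesis
      unfolding Suc Q_Suc using less.IH[of m] less.prems Suc by simp
  qed simp
qed

lemma Q_update: "n < i \<Longrightarrow> Q n (fun_upd \<omega> i x) = Q n \<omega>"
  by (rule Q_cong) auto

lemma hist_update: "n < i \<Longrightarrow> hist n (fun_upd \<omega> i x) = hist n \<omega>"
  by (auto simp: hist_def restrict_def fun_eq_iff Q_update)

lemma alive_update: "n < i \<Longrightarrow> alive n (fun_upd \<omega> i x) \<longleftrightarrow> alive n \<omega>"
  unfolding alive_def by (intro ball_cong refl) (auto simp: Q_update)

text \<open>The value of one more round. On stopping, \<open>f\<close> is taken at
  \<open>Q n\<close> and not at \<open>Q (Suc n)\<close>, because the game ends at the position with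
  index \<tau> - 1.\<close>

definition payoff :: "(heis \<Rightarrow> real) \<Rightarrow> (heis \<Rightarrow> real) \<Rightarrow> nat \<Rightarrow> (nat \<Rightarrow> outcome) \<Rightarrow> real" where
  "payoff g f n \<omega> = (if clk (Suc n) \<omega> \<le> cutoff D \<epsilon> (Q n \<omega>) then g (Q (Suc n) \<omega>) else f (Q n \<omega>))"

lemma measurable_payoff [measurable]:
  assumes [measurable]: "g \<in> borel_measurable borel" "f \<in> borel_measurable borel"
  shows "payoff g f n \<in> borel_measurable game_space"
  unfolding payoff_def[abs_def] using measurable_round[of "Suc n"] by measurable

lemma integral_payoff:
  assumes g: "g \<in> borel_measurable borel" "\<And>q. \<bar>g q\<bar> \<le> C"
  shows "(\<integral>x. payoff g f n (fun_upd \<omega> (Suc n) x) \<partial>step_space) =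
    cutoff D \<epsilon> (Q n \<omega>) * (1/3 * havg g \<epsilon> (Q n \<omega> \<odot> hdilate (gamma_p p * \<epsilon>) (\<sigma>\<^sub>I n (hist n \<omega>)))
      + 1/3 * havg g \<epsilon> (Q n \<omega> \<odot> hdilate (gamma_p p * \<epsilon>) (\<sigma>\<^sub>I\<^sub>I n (hist n \<omega>)))
      + 1/3 * havg g \<epsilon> (Q n \<omega>))
    + (1 - cutoff D \<epsilon> (Q n \<omega>)) * f (Q n \<omega>)"
proof -
  let ?m = "move (Q n \<omega>) (\<sigma>\<^sub>I n (hist n \<omega>)) (\<sigma>\<^sub>I\<^sub>I n (hist n \<omega>))"
  let ?G = "\<lambda>s w. g (?m s w)"
  have "payoff g f n (fun_upd \<omega> (Suc n) x) =
      (if snd (snd x) \<le> cutoff D \<epsilon> (Q n \<omega>) then ?G (fst (snd x)) (fst x) else f (Q n \<omega>))" for x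
    unfolding payoff_def Q_Suc by (simp add: Q_update hist_update)
  then have "(\<integral>x. payoff g f n (fun_upd \<omega> (Suc n) x) \<partial>step_space) =
      (\<integral>x. (if snd (snd x) \<le> cutoff D \<epsilon> (Q n \<omega>) then ?G (fst (snd x)) (fst x) else f (Q n \<omega>)) \<partial>step_space)"
    by simp
  also have "\<dots> = cutoff D \<epsilon> (Q n \<omega>) * (1/3 * (\<integral>w. ?G 1 w \<partial>noise) + 1/3 * (\<integral>w. ?G 2 w \<partial>noise)
      + 1/3 * (\<integral>w. ?G 3 w \<partial>noise)) + (1 - cutoff D \<epsilon> (Q n \<omega>)) * f (Q n \<omega>)"
  proof (rule integral_step_space[where G = ?G and C = C])
    show "?G s \<in> borel_measurable borel" for s
      unfolding move_def by (rule measurable_compose[OF _ g(1)]) (rule measurable_hmult_hdilate)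
  qed (use g(2) cutoff_bounds[OF \<epsilon> compl_D_ne] in auto)
  finally show ?thesis
    by (simp add: move_def havg_eq[OF \<epsilon> g(1)])
qed

lemma payoff_bounded:
  assumes "\<And>q. \<bar>g q\<bar> \<le> C" "\<And>q. \<bar>f q\<bar> \<le> C"
  shows "\<bar>payoff g f n \<omega>\<bar> \<le> C"
  using assms by (simp add: payoff_def del: split_paired_All)

lemma measurable_fun_upd_game_space:
  assumes "i \<ge> 1" "\<omega> \<in> space game_space"
  shows "fun_upd \<omega> i \<in> measurable step_space game_space"
proof -
  have "(\<lambda>x. fun_upd \<omega> i x) \<in> measurable step_space game_space"
    unfolding game_space_def
    by (rule measurable_fun_upd[where J = "{1..}"]) (use assms in \<open>auto simp: game_space_def\<close>)
  then show ?thesis by simp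
qed

text \<open>The integrated submartingale inequality on the event of survival. After resampling
  outcome \<open>n + 1\<close>, both \<open>alive n\<close> and \<open>Q n\<close> are constants of
  the inner integral, so the assumption applies to each \<omega> separately. It is used once for
  termination and once for the value of the game.\<close>

lemma expectation_payoff_nonneg:
  assumes g: "g \<in> borel_measurable borel" "\<And>q. \<bar>g q\<bar> \<le> C"
    and f: "f \<in> borel_measurable borel" "\<And>q. \<bar>f q\<bar> \<le> C"
    and k: "k \<in> borel_measurable borel" "\<And>q. \<bar>k q\<bar> \<le> C"
    and le: "\<And>\<omega>. \<omega> \<in> space game_space \<Longrightarrow>
      k (Q n \<omega>) \<le> (\<integral>x. payoff g f n (fun_upd \<omega> (Suc n) x) \<partial>step_space)"
  shows "0 \<le> (\<integral>\<omega>. (if alive n \<omega> then payoff g f n \<omega> - k (Q n \<omega>) else 0) \<partial>game_space)"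
proof -
  let ?f = "\<lambda>\<omega>. if alive n \<omega> then payoff g f n \<omega> - k (Q n \<omega>) else 0"
  have kQ [measurable]: "(\<lambda>\<omega>. k (Q n \<omega>)) \<in> borel_measurable game_space"
    by (rule measurable_compose[OF measurable_Q k(1)])
  have m: "?f \<in> borel_measurable game_space"
    using measurable_payoff[OF g(1) f(1), of n] by measurable
  have "(\<integral>\<omega>. ?f \<omega> \<partial>game_space) = (\<integral>\<omega>. \<integral>x. ?f (fun_upd \<omega> (Suc n) x) \<partial>step_space \<partial>game_space)"
  proof (rule integral_game_space_resample[where C = "2 * C"])
    fix \<omega>
    show "\<bar>?f \<omega>\<bar> \<le> 2 * C"
    proof -
      have "\<bar>payoff g f n \<omega> - k (Q n \<omega>)\<bar> \<le> 2 * C"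
        using payoff_bounded[where g = g and f = f and n = n and \<omega> = \<omega>, OF g(2) f(2)] k(2)[of "Q n \<omega>"]
        by linarith
      then show ?thesis by simp
    qed
  qed (simp_all add: m)
  also have "\<dots> \<ge> 0"
  proof (rule integral_nonneg_AE, rule AE_I2)
    fix \<omega> assume \<omega>: "\<omega> \<in> space game_space"
    have "integrable step_space (\<lambda>x. payoff g f n (fun_upd \<omega> (Suc n) x))"
    proof (rule step.integrable_const_bound[where B = C])
      show "(\<lambda>x. payoff g f n (fun_upd \<omega> (Suc n) x)) \<in> borel_measurable step_space"
        by (rule measurable_compose[OF measurable_fun_upd_game_space[OF _ \<omega>] measurable_payoff[OF g(1) f(1)]]) simp
    qed (use payoff_bounded[OF g(2) f(2)] in auto)
    then have "(\<integral>x. payoff g f n (fun_upd \<omega> (Suc n) x) - k (Q n \<omega>) \<partial>step_space) \<ge> 0"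
      using le[OF \<omega>] step.prob_space by simp
    then show "0 \<le> (\<integral>x. ?f (fun_upd \<omega> (Suc n) x) \<partial>step_space)"
      by (cases "alive n \<omega>") (simp_all add: alive_update Q_update)
  qed
  finally show ?thesis .
qed

section \<open>The game ends almost surely\<close>

text \<open>Whatever the strategies do, the two biased averages of the weight are at most
  \<open>B\<close>, so the mean weight of the surviving plays shrinks by the factor \<theta> in
  every round; on \<open>D\<close> the weight is bounded away from 0.\<close>

lemma prob_alive_tendsto_0: "(\<lambda>n. game.prob {\<omega> \<in> space game_space. alive n \<omega>}) \<longlonglongrightarrow> 0"
proof -
  obtain b \<theta> c B where b: "b \<in> borel_measurable borel" "0 \<le> \<theta>" "\<theta> < 1" "c > 0"
    "\<And>q. 0 \<le> b q" "\<And>q. b q \<le> B" "\<And>q. q \<in> D \<Longrightarrow> c \<le> b q" "\<And>q. q \<notin> D \<Longrightarrow> b q = 0"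
    "\<And>q. q \<in> D \<Longrightarrow> 1/3 * havg b \<epsilon> q + 2/3 * B \<le> \<theta> * b q"
    using contraction_weight[OF D \<epsilon>] by metis
  have bB: "\<bar>b q\<bar> \<le> B" for q using b(5,6)[of q] by linarith
  note d01 = cutoff_bounds[OF \<epsilon> compl_D_ne]
  define a where "a n = (\<integral>\<omega>. (if alive n \<omega> then b (Q n \<omega>) else 0) \<partial>game_space)" for n
  have bQ [measurable]: "(\<lambda>\<omega>. b (Q n \<omega>)) \<in> borel_measurable game_space" for n
    by (rule measurable_compose[OF measurable_Q b(1)])
  have int: "integrable game_space (\<lambda>\<omega>. if alive n \<omega> then b (Q n \<omega>) else 0)" for n
    by (rule game.integrable_const_bound[where B = B]) (use b(5,6) order_trans[OF b(5,6)] in \<open>auto intro!: AE_I2\<close>)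
  have step: "a (Suc n) \<le> \<theta> * a n" for n
  proof -
    \<comment> \<open>The general inequality gives lower bounds, hence the negated weight. Stopping
      pays 0, so only surviving plays contribute to the next mean.\<close>
    have "0 \<le> (\<integral>\<omega>. (if alive n \<omega> then payoff (\<lambda>q. - b q) (\<lambda>_. 0) n \<omega> - (- (\<theta> * b (Q n \<omega>))) else 0) \<partial>game_space)"
    proof (rule expectation_payoff_nonneg[where C = B])
      show "(\<lambda>q. - b q) \<in> borel_measurable borel" "(\<lambda>q. - (\<theta> * b q)) \<in> borel_measurable borel"
        using b(1) by simp_all
      show "\<bar>- b q\<bar> \<le> B" for q using bB by simp
      show "\<bar>0\<bar> \<le> B" using order_trans[OF b(5,6)] by simp
      show "\<bar>- (\<theta> * b q)\<bar> \<le> B" for q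
        using bB[of q] b(2,3,5) mult_left_le_one_le[of "b q" \<theta>] by (simp add: abs_mult)
      fix \<omega>
      let ?q = "Q n \<omega>"
      have nb: "(\<lambda>q. - b q) \<in> borel_measurable borel" "\<And>q. \<bar>- b q\<bar> \<le> B"
        using b(1) bB by simp_all
      have hn: "havg (\<lambda>q. - b q) \<epsilon> q = - havg b \<epsilon> q" for q
        using nb(1) b(1) by (simp add: havg_eq[OF \<epsilon>])
      have h: "havg b \<epsilon> q \<le> B" for q
        using havg_abs_le[OF \<epsilon> b(1) bB, of q] by linarith
      have h0: "havg b \<epsilon> q \<ge> 0" for q
        using b(5) by (simp add: havg_eq[OF \<epsilon> b(1)])
      let ?a = "havg b \<epsilon> (?q \<odot> hdilate (gamma_p p * \<epsilon>) (\<sigma>\<^sub>I n (hist n \<omega>)))"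
      let ?b = "havg b \<epsilon> (?q \<odot> hdilate (gamma_p p * \<epsilon>) (\<sigma>\<^sub>I\<^sub>I n (hist n \<omega>)))"
      have "cutoff D \<epsilon> ?q * (1/3 * ?a + 1/3 * ?b + 1/3 * havg b \<epsilon> ?q) \<le> \<theta> * b ?q"
      proof (cases "?q \<in> D")
        case True
        have "cutoff D \<epsilon> ?q * (1/3 * ?a + 1/3 * ?b + 1/3 * havg b \<epsilon> ?q) \<le> 1/3 * ?a + 1/3 * ?b + 1/3 * havg b \<epsilon> ?q"
          using h0 d01[of ?q] by (intro mult_left_le_one_le add_nonneg_nonneg) simp_all
        also have "\<dots> \<le> 1/3 * havg b \<epsilon> ?q + 2/3 * B"
          using h[of "?q \<odot> hdilate (gamma_p p * \<epsilon>) (\<sigma>\<^sub>I n (hist n \<omega>))"]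
            h[of "?q \<odot> hdilate (gamma_p p * \<epsilon>) (\<sigma>\<^sub>I\<^sub>I n (hist n \<omega>))"] by simp
        also have "\<dots> \<le> \<theta> * b ?q" by (rule b(9)[OF True])
        finally show ?thesis .
      next
        case False
        then show ?thesis using b(2,5) by (simp add: cutoff_eq_0[OF \<epsilon>])
      qed
      then show "- (\<theta> * b ?q) \<le> (\<integral>x. payoff (\<lambda>q. - b q) (\<lambda>_. 0) n (fun_upd \<omega> (Suc n) x) \<partial>step_space)"
        unfolding integral_payoff[OF nb] hn by (simp add: algebra_simps)
    qed simp
    also have "\<dots> = (\<integral>\<omega>. \<theta> * (if alive n \<omega> then b (Q n \<omega>) else 0)
        - (if alive (Suc n) \<omega> then b (Q (Suc n) \<omega>) else 0) \<partial>game_space)"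
      by (intro Bochner_Integration.integral_cong refl) (simp add: payoff_def alive_Suc del: position.simps)
    also have "\<dots> = \<theta> * a n - a (Suc n)"
      unfolding a_def by (subst Bochner_Integration.integral_diff) (use int in \<open>simp_all del: position.simps\<close>)
    finally show ?thesis by simp
  qed
  have "a n \<le> \<theta> ^ n * a 0" for n
  proof (induction n)
    case (Suc n)
    have "a (Suc n) \<le> \<theta> * a n" by (rule step)
    also have "\<dots> \<le> \<theta> * (\<theta> ^ n * a 0)" by (intro mult_left_mono Suc.IH b(2))
    finally show ?case by (simp add: mult.assoc)
  qed simp
  \<comment> \<open>The index shift matters: \<open>alive n\<close> does not place
    \<open>Q n\<close> in \<open>D\<close>, but surviving one round more does, since the clock is
    positive and the cutoff vanishes off \<open>D\<close>.\<close>
  moreover have "c * game.prob {\<omega> \<in> space game_space. alive (Suc n) \<omega>} \<le> a n" for n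
  proof -
    have "c * game.prob {\<omega> \<in> space game_space. alive (Suc n) \<omega>} =
        (\<integral>\<omega>. c * indicator {\<omega> \<in> space game_space. alive (Suc n) \<omega>} \<omega> \<partial>game_space)"
      by simp
    also have "\<dots> \<le> a n"
      unfolding a_def
    proof (rule integral_mono)
      show "integrable game_space (\<lambda>\<omega>. c * indicator {\<omega> \<in> space game_space. alive (Suc n) \<omega>} \<omega>)"
        by (intro integrable_mult_right integrable_real_indicator) (simp_all add: game.emeasure_eq_measure)
      fix \<omega> assume \<omega>: "\<omega> \<in> space game_space"
      have "\<omega> (Suc n) \<in> space step_space"
        using measurable_space[OF measurable_coordinate \<omega>] by simp
      then have "0 < clk (Suc n) \<omega>"
        by (auto simp: space_step_space mem_Times_iff)
      then have "Q n \<omega> \<in> D" if "alive (Suc n) \<omega>"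
        using that cutoff_eq_0[OF \<epsilon>, of "Q n \<omega>" D] unfolding alive_Suc by force
      then show "c * indicator {\<omega> \<in> space game_space. alive (Suc n) \<omega>} \<omega> \<le> (if alive n \<omega> then b (Q n \<omega>) else 0)"
        using b(5,7) by (auto simp: indicator_def alive_Suc simp del: position.simps)
    qed (rule int)
    finally show ?thesis .
  qed
  ultimately have le: "game.prob {\<omega> \<in> space game_space. alive (Suc n) \<omega>} \<le> \<theta> ^ n * (a 0 / c)" for n
    using b(4) order_trans by (fastforce simp: field_simps)
  have "(\<lambda>n. game.prob {\<omega> \<in> space game_space. alive (Suc n) \<omega>}) \<longlonglongrightarrow> 0"
  proof (rule tendsto_sandwich[OF always_eventually always_eventually tendsto_const])
    show "(\<lambda>n. \<theta> ^ n * (a 0 / c)) \<longlonglongrightarrow> 0"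
      using b(2,3) by (intro tendsto_mult_left_zero LIMSEQ_realpow_zero)
  qed (use le in simp_all)
  then show ?thesis by (rule LIMSEQ_imp_Suc)
qed

end

section \<open>Near-optimal play\<close>

context tug_of_war
begin

definition final :: "(nat \<Rightarrow> outcome) \<Rightarrow> heis" where
  "final \<omega> = Q (stop_time D p \<epsilon> q\<^sub>0 \<sigma>\<^sub>I \<sigma>\<^sub>I\<^sub>I \<omega> - 1) \<omega>"

lemma measurable_final [measurable]: "final \<in> borel_measurable game_space"
proof -
  have "Measurable.pred game_space (\<lambda>\<omega>. n \<ge> 1 \<and> clk n \<omega> > cutoff D \<epsilon> (Q (n - 1) \<omega>))" for n
  proof (cases "n \<ge> 1")
    case True
    then have "Measurable.pred game_space (\<lambda>\<omega>. \<not> clk n \<omega> \<le> cutoff D \<epsilon> (Q (n - 1) \<omega>))"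
      by (intro pred_intros_logic measurable_round)
    then show ?thesis using True by (simp add: not_le)
  qed simp
  then have "stop_time D p \<epsilon> q\<^sub>0 \<sigma>\<^sub>I \<sigma>\<^sub>I\<^sub>I \<in> measurable game_space (count_space UNIV)"
    unfolding stop_time_def[abs_def] by (rule measurable_Least)
  then show ?thesis
    unfolding final_def[abs_def]
    by (rule measurable_compose_countable[where f = "\<lambda>n \<omega>. Q (n - 1) \<omega>", OF measurable_Q])
qed

lemma final_eq:
  assumes "alive n \<omega>" "\<not> alive (Suc n) \<omega>"
  shows "final \<omega> = Q n \<omega>"
proof -
  have "stop_time D p \<epsilon> q\<^sub>0 \<sigma>\<^sub>I \<sigma>\<^sub>I\<^sub>I \<omega> = Suc n"
    unfolding stop_time_def
  proof (rule Least_equality)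
    show "1 \<le> Suc n \<and> clk (Suc n) \<omega> > cutoff D \<epsilon> (Q (Suc n - 1) \<omega>)"
      using assms by (simp add: alive_Suc)
    fix m assume m: "1 \<le> m \<and> clk m \<omega> > cutoff D \<epsilon> (Q (m - 1) \<omega>)"
    show "Suc n \<le> m"
    proof (rule ccontr)
      assume "\<not> Suc n \<le> m"
      then have "m \<in> {1..n}" using m by simp
      then have "clk m \<omega> \<le> cutoff D \<epsilon> (Q (m - 1) \<omega>)"
        using assms(1) unfolding alive_def by blast
      then show False using m by linarith
    qed
  qed
  then show ?thesis by (simp add: final_def)
qed

text \<open>Optional stopping by hand: the mean of \<open>u\<close> along the game, frozen at the
  payoff once the game is over, drops by at most \<open>e n\<close> in round \<open>n + 1\<close>.
  The total loss stays below \<open>s\<close>, and almost sure termination permits letting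
  \<open>n\<close> tend to infinity.\<close>

lemma expectation_final_ge:
  assumes sol: "dpp_solution D p F \<epsilon> u"
    and F: "continuous_on UNIV F" "bounded (range F)"
    and near: "\<And>n \<omega>. \<omega> \<in> space game_space \<Longrightarrow> (SUP q'\<in>hball (Q n \<omega>) (gamma_p p * \<epsilon>). havg u \<epsilon> q') - e n
      \<le> havg u \<epsilon> (Q n \<omega> \<odot> hdilate (gamma_p p * \<epsilon>) (\<sigma>\<^sub>I n (hist n \<omega>)))"
    and e: "\<And>n. 0 \<le> e n" "\<And>n. (\<Sum>i<n. e i) \<le> s"
  shows "u q\<^sub>0 - s \<le> (\<integral>\<omega>. F (final \<omega>) \<partial>game_space)"
proof -
  let ?r = "gamma_p p * \<epsilon>"
  note d01 = cutoff_bounds[OF \<epsilon> compl_D_ne]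
  have u: "continuous_on UNIV u" "bounded (range u)"
    and u_eq: "\<And>q. u q = cutoff D \<epsilon> q * dpp_mean ?r \<epsilon> u q + (1 - cutoff D \<epsilon> q) * F q"
    using sol unfolding dpp_solution_iff by blast+
  obtain C1 C2 where "\<And>q. \<bar>u q\<bar> \<le> C1" "\<And>q. \<bar>F q\<bar> \<le> C2"
    using u(2) F(2) unfolding bounded_iff by (metis rangeI real_norm_def)
  then obtain C where uC: "\<And>q. \<bar>u q\<bar> \<le> C" and FC: "\<And>q. \<bar>F q\<bar> \<le> C"
    by (metis max.coboundedI1 max.coboundedI2)
  have um [measurable]: "u \<in> borel_measurable borel" and Fm [measurable]: "F \<in> borel_measurable borel"
    using u(1) F(1) by (auto intro: borel_measurable_continuous_onI)
  have uQ [measurable]: "(\<lambda>\<omega>. u (Q n \<omega>)) \<in> borel_measurable game_space" for n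
    by (rule measurable_compose[OF measurable_Q um])
  have Ff [measurable]: "(\<lambda>\<omega>. F (final \<omega>)) \<in> borel_measurable game_space"
    by (rule measurable_compose[OF measurable_final Fm])
  define V where "V n \<omega> = (if alive n \<omega> then u (Q n \<omega>) else F (final \<omega>))" for n \<omega>
  have Vint: "integrable game_space (V n)" for n
    unfolding V_def[abs_def]
    by (rule game.integrable_const_bound[where B = C]) (simp_all add: uC FC)
  have Aint: "integrable game_space (\<lambda>\<omega>. indicator {\<omega> \<in> space game_space. alive n \<omega>} \<omega> :: real)" for n
    by (intro integrable_real_indicator) (simp_all add: game.emeasure_eq_measure)
  have step: "(\<integral>\<omega>. V n \<omega> \<partial>game_space) - e n \<le> (\<integral>\<omega>. V (Suc n) \<omega> \<partial>game_space)" for n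
  proof -
    let ?A = "{\<omega> \<in> space game_space. alive n \<omega>}"
    have "0 \<le> (\<integral>\<omega>. (if alive n \<omega> then payoff u F n \<omega> - (u (Q n \<omega>) - e n) else 0) \<partial>game_space)"
    proof (rule expectation_payoff_nonneg[where C = "C + e n"])
      show "\<bar>u q\<bar> \<le> C + e n" "\<bar>F q\<bar> \<le> C + e n" "\<bar>u q - e n\<bar> \<le> C + e n" for q
        using uC[of q] FC[of q] e(1)[of n] by linarith+
      fix \<omega> assume \<omega>: "\<omega> \<in> space game_space"
      let ?q = "Q n \<omega>"
      let ?b = "?q \<odot> hdilate ?r (\<sigma>\<^sub>I\<^sub>I n (hist n \<omega>))"
      \<comment> \<open>Any admissible reply of Player II is a competitor in the infimum, so it
        cannot push the average below it.\<close>
      have "?b \<in> hball ?q ?r"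
        using hmult_hdilate_mem_hball[OF step_pos] strategy_mem(2)[OF \<omega>] by blast
      then have "(INF q'\<in>hball ?q ?r. havg u \<epsilon> q') \<le> havg u \<epsilon> ?b"
        by (rule cINF_lower[OF bdd_havg(2)[OF \<epsilon> um uC]])
      then have "dpp_mean ?r \<epsilon> u ?q - e n \<le> 1/3 * havg u \<epsilon> (?q \<odot> hdilate ?r (\<sigma>\<^sub>I n (hist n \<omega>)))
          + 1/3 * havg u \<epsilon> ?b + 1/3 * havg u \<epsilon> ?q" (is "_ \<le> ?m")
        using near[OF \<omega>, of n] e(1)[of n] unfolding dpp_mean_def by linarith
      then have "cutoff D \<epsilon> ?q * (dpp_mean ?r \<epsilon> u ?q - e n) \<le> cutoff D \<epsilon> ?q * ?m"
        by (rule mult_left_mono) (rule d01)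
      moreover have "cutoff D \<epsilon> ?q * e n \<le> e n"
        by (rule mult_left_le_one_le) (use e(1) d01 in auto)
      ultimately have "u ?q - e n \<le> cutoff D \<epsilon> ?q * ?m + (1 - cutoff D \<epsilon> ?q) * F ?q"
        using u_eq[of ?q] unfolding right_diff_distrib by linarith
      then show "u ?q - e n \<le> (\<integral>x. payoff u F n (fun_upd \<omega> (Suc n) x) \<partial>step_space)"
        unfolding integral_payoff[OF um uC] .
    qed simp_all
    \<comment> \<open>If the play is alive at \<open>n\<close>, the payoff is
      \<open>V (Suc n)\<close>: either it survives, or it stops now and \<open>final\<close> is
      \<open>Q n\<close>. If it has ended before, both values of \<open>V\<close> are the same
      frozen payoff.\<close>
    also have "\<dots> = (\<integral>\<omega>. V (Suc n) \<omega> - V n \<omega> + e n * indicator ?A \<omega> \<partial>game_space)"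
    proof (rule Bochner_Integration.integral_cong[OF refl])
      fix \<omega> assume "\<omega> \<in> space game_space"
      then show "(if alive n \<omega> then payoff u F n \<omega> - (u (Q n \<omega>) - e n) else 0)
          = V (Suc n) \<omega> - V n \<omega> + e n * indicator ?A \<omega>"
        using final_eq[of n \<omega>]
        by (auto simp: V_def payoff_def alive_Suc indicator_def simp del: position.simps)
    qed
    also have "\<dots> = (\<integral>\<omega>. V (Suc n) \<omega> \<partial>game_space) - (\<integral>\<omega>. V n \<omega> \<partial>game_space) + e n * game.prob ?A"
      using Vint Aint by simp
    finally have "(\<integral>\<omega>. V n \<omega> \<partial>game_space) - e n * game.prob ?A \<le> (\<integral>\<omega>. V (Suc n) \<omega> \<partial>game_space)"
      by linarith
    moreover have "e n * game.prob ?A \<le> e n"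
      using e(1)[of n] by (intro mult_left_le) auto
    ultimately show ?thesis by linarith
  qed
  have "u q\<^sub>0 - (\<Sum>i<n. e i) \<le> (\<integral>\<omega>. V n \<omega> \<partial>game_space)" for n
  proof (induction n)
    case 0
    then show ?case using game.prob_space by (simp add: V_def)
  next
    case (Suc n)
    then show ?case using step[of n] by simp
  qed
  then have lower: "u q\<^sub>0 - s \<le> (\<integral>\<omega>. V n \<omega> \<partial>game_space)" for n
    using e(2)[of n] by (meson diff_left_mono order_trans)
  \<comment> \<open>\<open>V n\<close> differs from the final payoff only on plays still alive, and
    there by at most \<open>2 * C\<close>.\<close>
  have diff: "(\<integral>\<omega>. V n \<omega> \<partial>game_space) \<le> (\<integral>\<omega>. F (final \<omega>) \<partial>game_space)
      + 2 * C * game.prob {\<omega> \<in> space game_space. alive n \<omega>}" for n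
  proof -
    have Fint: "integrable game_space (\<lambda>\<omega>. F (final \<omega>))"
      by (rule game.integrable_const_bound[where B = C]) (simp_all add: FC)
    have "(\<integral>\<omega>. V n \<omega> \<partial>game_space) \<le>
      (\<integral>\<omega>. F (final \<omega>) + 2 * C * indicator {\<omega> \<in> space game_space. alive n \<omega>} \<omega> \<partial>game_space)"
    proof (rule integral_mono)
      show "integrable game_space (\<lambda>\<omega>. F (final \<omega>) + 2 * C * indicator {\<omega> \<in> space game_space. alive n \<omega>} \<omega>)"
        by (intro Bochner_Integration.integrable_add integrable_mult_right Fint Aint)
      fix \<omega> assume "\<omega> \<in> space game_space"
      moreover have "u (Q n \<omega>) \<le> F (final \<omega>) + 2 * C"
        using uC[of "Q n \<omega>"] FC[of "final \<omega>"] by linarith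
      ultimately show "V n \<omega> \<le> F (final \<omega>) + 2 * C * indicator {\<omega> \<in> space game_space. alive n \<omega>} \<omega>"
        by (simp add: V_def indicator_def del: position.simps)
    qed (rule Vint)
    then show ?thesis
      using Fint Aint by simp
  qed
  have "(\<lambda>n. (\<integral>\<omega>. F (final \<omega>) \<partial>game_space) + 2 * C * game.prob {\<omega> \<in> space game_space. alive n \<omega>})
      \<longlonglongrightarrow> (\<integral>\<omega>. F (final \<omega>) \<partial>game_space) + 2 * C * 0"
    by (intro tendsto_intros prob_alive_tendsto_0)
  then show ?thesis
    using order_trans[OF lower diff] by (intro LIMSEQ_le_const[of _ _ "u q\<^sub>0 - s"]) (auto simp del: position.simps)
qed

end

section \<open>Measurable near-optimal moves\<close>

text \<open>By continuity the moves that come within \<open>e\<close> of the supremum form a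
  nonempty open set, so some member of a countable dense subset of the unit ball is among them.
  Taking the first such member is measurable in \<open>q\<close>, because each single candidate is
  tested by a measurable predicate.\<close>

lemma near_sup_selector:
  fixes g :: "heis \<Rightarrow> real"
  assumes r: "r > 0" and g: "continuous_on UNIV g" "\<And>q. \<bar>g q\<bar> \<le> C" and e: "e > 0"
  obtains s where "s \<in> measurable borel (restrict_space borel (hball 0 1))"
    "\<And>q. (SUP q'\<in>hball q r. g q') - e \<le> g (q \<odot> hdilate r (s q))"
proof -
  obtain A :: "heis set" where A: "countable A" "\<And>X. open X \<Longrightarrow> X \<noteq> {} \<Longrightarrow> \<exists>d\<in>A. d \<in> X"
    using countable_dense_exists by metis
  have "A \<inter> hball 0 1 \<noteq> {}"
    using A(2)[OF open_hball] zero_mem_unit_hball by blast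
  moreover have "countable (A \<inter> hball 0 1)"
    using A(1) by simp
  ultimately obtain W :: "nat \<Rightarrow> heis" where W: "range W = A \<inter> hball 0 1"
    using range_from_nat_into by metis
  define S where "S q = (SUP w\<in>hball 0 1. g (q \<odot> hdilate r w))" for q
  have S: "(SUP q'\<in>hball q r. g q') = S q" for q
    by (simp add: S_def hball_eq_image[OF r] image_image)
  have "continuous_on UNIV (\<lambda>x. g (fst x \<odot> hdilate r (snd x)))"
    by (intro continuous_on_compose2[OF g(1)] continuous_intros) simp
  then have "continuous_on UNIV S"
    unfolding S_def by (intro continuous_on_SUP bounded_unit_hball) (use zero_mem_unit_hball in blast)+
  then have Sm [measurable]: "S \<in> borel_measurable borel"
    by (rule borel_measurable_continuous_onI)
  have ex: "\<exists>n. S q - e < g (q \<odot> hdilate r (W n))" for q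
  proof -
    let ?O = "hball 0 1 \<inter> {w. S q - e < g (q \<odot> hdilate r w)}"
    have "continuous_on UNIV (\<lambda>w. g (q \<odot> hdilate r w))"
      by (intro continuous_on_compose2[OF g(1)] continuous_intros) simp
    then have "open ?O"
      by (intro open_Int open_hball open_Collect_less continuous_on_const)
    moreover have "\<exists>w\<in>hball 0 1. S q - e < g (q \<odot> hdilate r w)"
    proof -
      have "bdd_above ((\<lambda>w. g (q \<odot> hdilate r w)) ` hball 0 1)"
        by (rule bdd_aboveI2[of _ _ C]) (use g(2) abs_le_D1 in blast)
      moreover have "S q - e < S q" using e by simp
      ultimately show ?thesis
        unfolding S_def by (subst (asm) less_cSUP_iff) (use zero_mem_unit_hball in blast)+
    qed
    ultimately obtain w where "w \<in> A" "w \<in> ?O"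
      using A(2)[of ?O] by blast
    then obtain n where "w = W n" using W by blast
    then show ?thesis using \<open>w \<in> ?O\<close> by blast
  qed
  define s where "s q = W (LEAST n. S q - e < g (q \<odot> hdilate r (W n)))" for q
  show thesis
  proof (rule that[of s])
    have "(\<lambda>q. LEAST n. S q - e < g (q \<odot> hdilate r (W n))) \<in> measurable borel (count_space UNIV)"
    proof (rule measurable_Least)
      fix n
      have "continuous_on UNIV (\<lambda>q. g (q \<odot> hdilate r (W n)))"
        by (intro continuous_on_compose2[OF g(1)] continuous_intros) simp
      then have [measurable]: "(\<lambda>q. g (q \<odot> hdilate r (W n))) \<in> borel_measurable borel"
        by (rule borel_measurable_continuous_onI)
      show "Measurable.pred borel (\<lambda>q. S q - e < g (q \<odot> hdilate r (W n)))"
        by measurable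
    qed
    then have "s \<in> borel_measurable borel"
      unfolding s_def by (rule measurable_compose) simp
    moreover have "s q \<in> hball 0 1" for q
      using W unfolding s_def by blast
    ultimately show "s \<in> measurable borel (restrict_space borel (hball 0 1))"
      by (intro measurable_restrict_space2) auto
    show "(SUP q'\<in>hball q r. g q') - e \<le> g (q \<odot> hdilate r (s q))" for q
      using LeastI_ex[OF ex[of q]] unfolding S s_def by linarith
  qed
qed

text \<open>The entries of a history start at index 1; for \<open>n = 0\<close> the current position
  is the initial one, stored separately in the first component.\<close>

definition last_position :: "nat \<Rightarrow> history \<Rightarrow> heis" where
  "last_position n h = (if n = 0 then fst h else fst (snd h n))"

lemma measurable_last_position: "last_position n \<in> borel_measurable (history_space n)"
proof (cases "n = 0")
  case True
  then show ?thesis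
    unfolding last_position_def[abs_def] history_space_def by simp
next
  case False
  have "(\<lambda>h. snd h n) \<in> measurable (history_space n) (borel \<Otimes>\<^sub>M step_space)"
    unfolding history_space_def using False
    by (intro measurable_compose[OF measurable_snd] measurable_component_singleton) simp
  from measurable_compose[OF this measurable_fst]
  have "(\<lambda>h. fst (snd h n)) \<in> borel_measurable (history_space n)" .
  then show ?thesis
    using False unfolding last_position_def[abs_def] by simp
qed

lemma (in tug_of_war) last_position_hist: "last_position n (hist n \<omega>) = Q n \<omega>"
  by (cases n) (simp_all add: last_position_def hist_def)

theorem lemma13p4:
  fixes p :: real and D :: "heis set"
  assumes "p > 2"
    and "open D" and "bounded D" and "connected D"
    and equicontinuity: "\<And>(F :: heis \<Rightarrow> real) (u :: real \<Rightarrow> heis \<Rightarrow> real).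
           continuous_on UNIV F \<Longrightarrow> bounded (range F) \<Longrightarrow>
           (\<forall>\<epsilon>\<in>{0<..<1}. dpp_solution D p F \<epsilon> (u \<epsilon>)) \<Longrightarrow>
           equicontinuous_family_on (closure D) u"
  shows "game_regular D p"
proof -
  have regular: "game_regular_point D p x" if x: "x \<in> frontier D" for x
    unfolding game_regular_point_def
  proof (intro allI impI)
    fix \<eta> \<delta> :: real assume "\<eta> > 0" "\<delta> > 0"
    \<comment> \<open>Outside \<open>hball x \<delta>\<close> the payoff is at most -
      \<open>m\<close>. The half in \<open>s\<close> is there because \<open>s\<close> is lost
      twice, once in the bound for \<open>u\<close> at the starting point and once in the errors of
      Player I; Markov's inequality then leaves 2 \<open>s\<close> / \<open>m\<close> =
      \<eta>.\<close>
    define m where "m = min 1 \<delta>"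
    define s where "s = \<eta> * m / 2"
    have m: "m > 0" "m \<le> 1" "m \<le> \<delta>" and s: "s > 0"
      using \<open>\<eta> > 0\<close> \<open>\<delta> > 0\<close> by (auto simp: m_def s_def)
    define F where "F q = - min 1 (hdist x q)" for q
    have F: "continuous_on UNIV F" "bounded (range F)"
    proof -
      show "continuous_on UNIV F"
        unfolding F_def by (intro continuous_intros)
      have "\<bar>F q\<bar> \<le> 1" for q
        using hdist_nonneg[of x q] unfolding F_def by linarith
      then show "bounded (range F)"
        by (intro boundedI[of _ 1]) (metis imageE real_norm_def)
    qed
    have "\<exists>u. \<forall>\<epsilon>\<in>{0<..<1}. dpp_solution D p F \<epsilon> (u \<epsilon>)"
      by (rule bchoice) (use dpp_solution_exists[OF \<open>bounded D\<close> \<open>open D\<close> _ \<open>p > 2\<close> F] in simp)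
    then obtain u where u: "\<forall>\<epsilon>\<in>{0<..<1}. dpp_solution D p F \<epsilon> (u \<epsilon>)"
      by blast
    obtain d \<epsilon>' where d: "d > 0" and \<epsilon>': "\<epsilon>' \<in> {0<..<1}"
      and eq: "\<And>\<epsilon> q q'. \<epsilon> \<in> {0<..<\<epsilon>'} \<Longrightarrow> q \<in> closure D \<Longrightarrow> q' \<in> closure D \<Longrightarrow> norm (q - q') \<le> d \<Longrightarrow>
        \<bar>u \<epsilon> q - u \<epsilon> q'\<bar> \<le> s"
      using equicontinuity[OF F u] s unfolding equicontinuous_family_on_def by metis
    obtain d' where d': "d' > 0" "\<And>q. q \<in> hball x d' \<Longrightarrow> norm (q - x) < d"
      using ball_contains_hball[OF d] by metis
    \<comment> \<open>The bound \<open>d'\<close> serves starting points in the closure of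
      \<open>D\<close> through equicontinuity, the bound \<open>s\<close> serves those outside, and
      \<delta> / 2 keeps \<delta>' strictly below \<delta>.\<close>
    define \<delta>' where "\<delta>' = min (min d' s) (\<delta> / 2)"
    have \<delta>': "\<delta>' \<in> {0<..<\<delta>}" "\<delta>' \<le> d'" "\<delta>' \<le> s"
      using d'(1) s \<open>\<delta> > 0\<close> by (auto simp: \<delta>'_def)
    have "x \<notin> D" "x \<in> closure D"
      using x \<open>open D\<close> by (auto simp: frontier_def interior_open simp del: split_paired_All)
    have main: "\<exists>\<sigma>\<^sub>I. strategy \<sigma>\<^sub>I \<and> (\<forall>\<sigma>\<^sub>I\<^sub>I. strategy \<sigma>\<^sub>I\<^sub>I \<longrightarrow>
          measure game_space {\<omega> \<in> space game_space.
            position p \<epsilon> p\<^sub>0 \<sigma>\<^sub>I \<sigma>\<^sub>I\<^sub>I (stop_time D p \<epsilon> p\<^sub>0 \<sigma>\<^sub>I \<sigma>\<^sub>I\<^sub>I \<omega> - 1) \<omega> \<in> hball x \<delta>} \<ge> 1 - \<eta>)"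
      if "\<epsilon> \<in> {0<..<\<epsilon>'}" and p\<^sub>0: "p\<^sub>0 \<in> hball x \<delta>'" for \<epsilon> p\<^sub>0
    proof -
      have \<epsilon>: "\<epsilon> > 0" "\<epsilon> \<in> {0<..<1}" using that(1) \<epsilon>' by auto
      let ?r = "gamma_p p * \<epsilon>"
      have r: "?r > 0" using \<open>p > 2\<close> \<epsilon> by (simp add: gamma_p_def)
      have sol: "dpp_solution D p F \<epsilon> (u \<epsilon>)" using u \<epsilon>(2) by blast
      then have uc: "continuous_on UNIV (u \<epsilon>)" "bounded (range (u \<epsilon>))"
        and outside: "\<And>q. q \<notin> D \<Longrightarrow> u \<epsilon> q = F q"
        unfolding dpp_solution_iff using cutoff_eq_0[OF \<epsilon>(1)] by (blast, blast, metis add_0 diff_zero mult_1 mult_zero_left)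
      have u_lower: "u \<epsilon> p\<^sub>0 \<ge> - s"
      proof (cases "p\<^sub>0 \<in> closure D")
        case True
        have "u \<epsilon> x = 0"
          using outside[OF \<open>x \<notin> D\<close>] by (simp add: F_def)
        moreover have "p\<^sub>0 \<in> hball x d'"
          using p\<^sub>0 \<delta>'(2) by (simp add: mem_hball)
        ultimately show ?thesis
          using eq[OF that(1) True \<open>x \<in> closure D\<close>] d'(2)[of p\<^sub>0] by fastforce
      next
        case False
        then have "u \<epsilon> p\<^sub>0 = F p\<^sub>0"
          using outside closure_subset by blast
        then show ?thesis
          using p\<^sub>0 \<delta>'(3) unfolding F_def mem_hball by linarith
      qed
      obtain C where C: "\<And>q. \<bar>u \<epsilon> q\<bar> \<le> C"
        using uc(2) unfolding bounded_iff by (metis rangeI real_norm_def)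
      have hc: "continuous_on UNIV (havg (u \<epsilon>) \<epsilon>)" "\<And>q. \<bar>havg (u \<epsilon>) \<epsilon> q\<bar> \<le> C"
        using continuous_on_havg[OF \<epsilon>(1) uc(1) C] havg_abs_le[OF \<epsilon>(1) borel_measurable_continuous_onI[OF uc(1)] C]
        by blast+
      \<comment> \<open>A fixed error per round would add up without bound, as the number of rounds
        is not bounded; these errors sum to at most \<open>s\<close>.\<close>
      define e where "e n = s * (1 / 2) ^ Suc n" for n
      have e: "e n > 0" "(\<Sum>i<n. e i) \<le> s" for n
      proof -
        show "e n > 0" using s by (simp add: e_def)
        have "(\<Sum>i<n. e i) = s * (1 - (1 / 2) ^ n)"
          unfolding e_def by (induction n) (simp_all add: algebra_simps)
        also have "\<dots> \<le> s" using s by (simp add: mult_left_le)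
        finally show "(\<Sum>i<n. e i) \<le> s" .
      qed
      have "\<forall>n. \<exists>f. f \<in> measurable borel (restrict_space borel (hball 0 1)) \<and>
          (\<forall>q. (SUP q'\<in>hball q ?r. havg (u \<epsilon>) \<epsilon> q') - e n \<le> havg (u \<epsilon>) \<epsilon> (q \<odot> hdilate ?r (f q)))"
        using near_sup_selector[OF r hc e(1)] by metis
      then obtain f where f: "\<And>n. f n \<in> measurable borel (restrict_space borel (hball 0 1))"
        "\<And>n q. (SUP q'\<in>hball q ?r. havg (u \<epsilon>) \<epsilon> q') - e n \<le> havg (u \<epsilon>) \<epsilon> (q \<odot> hdilate ?r (f n q))"
        by metis
      \<comment> \<open>Player I looks only at the round number and the current position, so the
        strategy is fixed before that of Player II is known, as the order of quantifiers
        demands.\<close>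
      define \<sigma>\<^sub>I where "\<sigma>\<^sub>I n h = f n (last_position n h)" for n h
      have strat: "strategy \<sigma>\<^sub>I"
        unfolding strategy_def \<sigma>\<^sub>I_def using measurable_compose[OF measurable_last_position f(1)] by blast
      have "measure game_space {\<omega> \<in> space game_space.
            position p \<epsilon> p\<^sub>0 \<sigma>\<^sub>I \<sigma>\<^sub>I\<^sub>I (stop_time D p \<epsilon> p\<^sub>0 \<sigma>\<^sub>I \<sigma>\<^sub>I\<^sub>I \<omega> - 1) \<omega> \<in> hball x \<delta>} \<ge> 1 - \<eta>"
        if "strategy \<sigma>\<^sub>I\<^sub>I" for \<sigma>\<^sub>I\<^sub>I
      proof -
        interpret tug_of_war D p \<epsilon> p\<^sub>0 \<sigma>\<^sub>I \<sigma>\<^sub>I\<^sub>I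
          by unfold_locales (fact \<open>p > 2\<close> \<epsilon>(1) \<open>bounded D\<close> \<open>open D\<close> strat that)+
        let ?G = "{\<omega> \<in> space game_space. final \<omega> \<in> hball x \<delta>}"
        have "u \<epsilon> p\<^sub>0 - s \<le> (\<integral>\<omega>. F (final \<omega>) \<partial>game_space)"
        proof (rule expectation_final_ge[OF sol F, where e = e])
          show "(SUP q'\<in>hball (Q n \<omega>) ?r. havg (u \<epsilon>) \<epsilon> q') - e n
            \<le> havg (u \<epsilon>) \<epsilon> (Q n \<omega> \<odot> hdilate ?r (\<sigma>\<^sub>I n (hist n \<omega>)))" for n \<omega>
            unfolding \<sigma>\<^sub>I_def last_position_hist by (rule f(2))
        qed (use e less_imp_le in blast)+
        \<comment> \<open>Markov's inequality in pointwise form: \<open>F\<close> is at most 0 on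
          \<open>?G\<close> and at most - \<open>m\<close> off it.\<close>
        also have "\<dots> \<le> (\<integral>\<omega>. m * indicator ?G \<omega> - m \<partial>game_space)"
        proof (rule integral_mono)
          have Fm: "F \<in> borel_measurable borel"
            by (rule borel_measurable_continuous_onI) (rule F(1))
          have "\<bar>F q\<bar> \<le> 1" for q
            using hdist_nonneg[of x q] unfolding F_def by linarith
          then show "integrable game_space (\<lambda>\<omega>. F (final \<omega>))"
            by (intro game.integrable_const_bound[where B = 1] measurable_compose[OF measurable_final Fm]) auto
          have "?G \<in> sets game_space" by measurable
          then show "integrable game_space (\<lambda>\<omega>. m * indicator ?G \<omega> - m)"
            by (intro Bochner_Integration.integrable_diff integrable_mult_right integrable_real_indicator)
              (simp_all add: game.emeasure_eq_measure)
          fix \<omega> assume "\<omega> \<in> space game_space"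
          then show "F (final \<omega>) \<le> m * indicator ?G \<omega> - m"
            using hdist_nonneg[of x "final \<omega>"] m by (auto simp: F_def indicator_def mem_hball)
        qed
        also have "\<dots> = m * game.prob ?G - m"
        proof -
          have "?G \<in> sets game_space" by measurable
          then have "integrable game_space (\<lambda>\<omega>. m * indicator ?G \<omega>)"
            by (intro integrable_mult_right integrable_real_indicator) (simp_all add: game.emeasure_eq_measure)
          then show ?thesis using game.prob_space by simp
        qed
        finally have "- (2 * s) \<le> m * game.prob ?G - m"
          using u_lower by linarith
        then have "m * (1 - \<eta>) \<le> m * game.prob ?G"
          by (simp add: s_def algebra_simps)
        then show ?thesis
          using m(1) unfolding final_def by simp
      qed
      then show ?thesis using strat by blast
    qed
    show "\<exists>\<delta>'\<in>{0<..<\<delta>}. \<exists>\<epsilon>'\<in>{0<..<1}. \<forall>\<epsilon>\<in>{0<..<\<epsilon>'}. \<forall>p\<^sub>0\<in>hball x \<delta>'.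
        \<exists>\<sigma>\<^sub>I. strategy \<sigma>\<^sub>I \<and> (\<forall>\<sigma>\<^sub>I\<^sub>I. strategy \<sigma>\<^sub>I\<^sub>I \<longrightarrow>
          measure game_space {\<omega> \<in> space game_space.
            position p \<epsilon> p\<^sub>0 \<sigma>\<^sub>I \<sigma>\<^sub>I\<^sub>I (stop_time D p \<epsilon> p\<^sub>0 \<sigma>\<^sub>I \<sigma>\<^sub>I\<^sub>I \<omega> - 1) \<omega> \<in> hball x \<delta>} \<ge> 1 - \<eta>)"
      by (intro bexI[OF _ \<delta>'(1)] bexI[OF _ \<epsilon>'] ballI main)
  qed
  then show ?thesis
    unfolding game_regular_def by blast
qed

end
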